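(* Let $M$ be a fixed positive integer. The following decision problem is solvable in polynomial time: given a finite connected graph $G=(V,E)$, a subset $V'\subseteq V$ and a function $f':V'\to\mathbb{Z}$, decide whether there exists an $M$-Lipschitz mapping $f$ of $G$ such that $f$ extends $f'$ (i.e. $f(v)=f'(v)$ for all $v\in V'$).
   Context: An $M$-Lipschitz mapping of a connected graph $G=(V,E)$ is a mapping $f:V\to\mathbb{Z}$ such that $|f(u)-f(v)|\le M$ for every edge $uv\in E$ and some vertex, the root, is mapped to $0$. In this problem the root is not part of the input: $f$ is only required to take the value $0$ at some vertex of $G$. *)

theory Defs
  imports "HOL-Computational_Algebra.Polynomial" "HOL-Library.Log_Nat"
begin

section \<open>Polynomial time on the logarithmic-cost RAM\<close>

text \<open>
  The model of computation is the random access machine on integers with addition and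
  subtraction (no multiplication) under the logarithmic cost criterion. It simulates and is
  simulated by multitape Turing machines with polynomial overhead.
\<close>

datatype instr =
    Const nat int      \<comment> \<open>\<open>R i := c\<close>\<close>
  | Copy nat nat       \<comment> \<open>\<open>R i := R j\<close>\<close>
  | Add nat nat nat    \<comment> \<open>\<open>R i := R j + R k\<close>\<close>
  | Sub nat nat nat    \<comment> \<open>\<open>R i := R j - R k\<close>\<close>
  | Load nat nat       \<comment> \<open>\<open>R i := R (R j)\<close>\<close>
  | Store nat nat      \<comment> \<open>\<open>R (R i) := R j\<close>\<close>
  | Jump nat           \<comment> \<open>\<open>goto l\<close>\<close>
  | JumpPos nat nat    \<comment> \<open>\<open>if R i > 0 then goto l\<close>\<close>

type_synonym registers = "nat \<Rightarrow> int"
type_synonym config = "nat \<times> registers"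

text \<open>Indirect addressing through a negative register content refers to register 0.\<close>

fun step :: "instr \<Rightarrow> config \<Rightarrow> config" where
  "step (Const i c) (pc, R) = (Suc pc, R(i := c))"
| "step (Copy i j) (pc, R) = (Suc pc, R(i := R j))"
| "step (Add i j k) (pc, R) = (Suc pc, R(i := R j + R k))"
| "step (Sub i j k) (pc, R) = (Suc pc, R(i := R j - R k))"
| "step (Load i j) (pc, R) = (Suc pc, R(i := R (nat (R j))))"
| "step (Store i j) (pc, R) = (Suc pc, R(nat (R i) := R j))"
| "step (Jump l) (pc, R) = (l, R)"
| "step (JumpPos i l) (pc, R) = (if R i > 0 then l else Suc pc, R)"

text \<open>Length of the binary representation; the extra 1 accounts for the sign.\<close>

definition bits :: "int \<Rightarrow> nat" where
  "bits z = Suc (floorlog 2 (nat \<bar>z\<bar>))"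

text \<open>The cost of a step is the total length of the addresses and contents it touches.\<close>

fun cost :: "instr \<Rightarrow> registers \<Rightarrow> nat" where
  "cost (Const i c) R = bits (int i) + bits c"
| "cost (Copy i j) R = bits (int i) + bits (int j) + bits (R j)"
| "cost (Add i j k) R =
     bits (int i) + bits (int j) + bits (int k) + bits (R j) + bits (R k)"
| "cost (Sub i j k) R =
     bits (int i) + bits (int j) + bits (int k) + bits (R j) + bits (R k)"
| "cost (Load i j) R = bits (int i) + bits (int j) + bits (R j) + bits (R (nat (R j)))"
| "cost (Store i j) R = bits (int i) + bits (int j) + bits (R i) + bits (R j)"
| "cost (Jump l) R = 1"
| "cost (JumpPos i l) R = bits (int i) + bits (R i)"

text \<open>
  \<open>exec P (pc, R) t R'\<close>: the program \<open>P\<close>, started at instruction \<open>pc\<close> with register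
  contents \<open>R\<close>, halts at total cost \<open>t\<close> with register contents \<open>R'\<close>. A program halts when
  the program counter leaves it.
\<close>

inductive exec :: "instr list \<Rightarrow> config \<Rightarrow> nat \<Rightarrow> registers \<Rightarrow> bool" for P where
  halt: "length P \<le> pc \<Longrightarrow> exec P (pc, R) 0 R"
| step: "pc < length P \<Longrightarrow> exec P (step (P ! pc) (pc, R)) t R'
         \<Longrightarrow> exec P (pc, R) (cost (P ! pc) R + t) R'"

lemma exec_deterministic:
  assumes "exec P c t R" "exec P c t' R'"
  shows "t = t' \<and> R = R'"
  using assms
proof (induction arbitrary: t' R' rule: exec.induct)
  case (halt pc R)
  then show ?case by (auto elim: exec.cases)
next
  case (step pc R t R1)
  from step.prems step.hyps(1) obtain s where
    "exec P (Defs.step (P ! pc) (pc, R)) s R'" "t' = cost (P ! pc) R + s"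
    by (auto elim: exec.cases)
  then show ?case using step.IH by auto
qed

text \<open>
  Inputs are finite sequences of integers in binary. Initially register 0 holds the number
  of input integers, registers 1, 2, ... hold the input, and all others are 0.
\<close>

definition init :: "int list \<Rightarrow> registers" where
  "init xs i =
     (if i = 0 then int (length xs) else if i \<le> length xs then xs ! (i - 1) else 0)"

definition input_size :: "int list \<Rightarrow> nat" where
  "input_size xs = sum_list (map bits xs)"

text \<open>
  A decision problem is given by the set \<open>L\<close> of (encodings of) its yes-instances; every other
  input, in particular every malformed one, must be rejected. Acceptance is signalled by the
  value 1 in register 0.
\<close>

definition polynomial_time_decidable :: "int list set \<Rightarrow> bool" where
  "polynomial_time_decidable L \<longleftrightarrow>
     (\<exists>(P :: instr list) (p :: nat poly). \<forall>xs. \<exists>t R.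
        exec P (0, init xs) t R \<and> t \<le> poly p (input_size xs) \<and> (R 0 = 1 \<longleftrightarrow> xs \<in> L))"


section \<open>Lipschitz mappings of graphs\<close>

definition finite_simple_graph :: "'a set \<Rightarrow> 'a set set \<Rightarrow> bool" where
  "finite_simple_graph V E \<longleftrightarrow>
     finite V \<and> E \<subseteq> {{u, v} | u v. u \<in> V \<and> v \<in> V \<and> u \<noteq> v}"

definition connected_graph :: "'a set \<Rightarrow> 'a set set \<Rightarrow> bool" where
  "connected_graph V E \<longleftrightarrow>
     V \<noteq> {} \<and> (\<forall>u\<in>V. \<forall>v\<in>V. (u, v) \<in> {(x, y). {x, y} \<in> E}\<^sup>*)"

definition lipschitz_mapping :: "int \<Rightarrow> 'a set \<Rightarrow> 'a set set \<Rightarrow> ('a \<Rightarrow> int) \<Rightarrow> bool" where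
  "lipschitz_mapping M V E f \<longleftrightarrow>
     (\<forall>u v. {u, v} \<in> E \<longrightarrow> \<bar>f u - f v\<bar> \<le> M) \<and> (\<exists>r\<in>V. f r = 0)"

text \<open>
  An instance with vertex set \<open>{..<n}\<close> is encoded as \<open>n\<close>, followed by the rows of the
  adjacency matrix, the characteristic vector of \<open>V'\<close>, and the values of \<open>f'\<close>, where the
  entries at vertices outside \<open>V'\<close> are set to 0.
\<close>

definition encode_instance ::
  "nat \<Rightarrow> nat set set \<Rightarrow> nat set \<Rightarrow> (nat \<Rightarrow> int) \<Rightarrow> int list" where
  "encode_instance n E V' f' =
     int n #
     concat (map (\<lambda>u. map (\<lambda>v. of_bool ({u, v} \<in> E)) [0..<n]) [0..<n]) @
     map (\<lambda>v. of_bool (v \<in> V')) [0..<n] @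
     map (\<lambda>v. if v \<in> V' then f' v else 0) [0..<n]"

lemma encode_instance_inject:
  assumes eq: "encode_instance n E V' f' = encode_instance m F W' g'"
    and "finite_simple_graph {..<n} E" "finite_simple_graph {..<m} F"
    and "V' \<subseteq> {..<n}" "W' \<subseteq> {..<m}"
  shows "n = m \<and> E = F \<and> V' = W' \<and> (\<forall>v\<in>V'. f' v = g' v)"
proof -
  have nm: "n = m" using eq by (simp add: encode_instance_def)
  let ?A = "\<lambda>E. map (\<lambda>u. map (\<lambda>v. of_bool ({u, v} \<in> E) :: int) [0..<n]) [0..<n]"
  have len: "length (concat (?A E)) = length (concat (?A F))"
    by (simp add: length_concat comp_def)
  have parts: "concat (?A E) = concat (?A F)"
    "map (\<lambda>v. of_bool (v \<in> V') :: int) [0..<n] = map (\<lambda>v. of_bool (v \<in> W')) [0..<n]"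
    "map (\<lambda>v. if v \<in> V' then f' v else 0) [0..<n] =
     map (\<lambda>v. if v \<in> W' then g' v else 0) [0..<n]"
    using eq len unfolding encode_instance_def nm by (auto simp: append_eq_append_conv)
  have "?A E = ?A F"
    using parts(1) by (subst (asm) concat_eq_concat_iff) (auto simp: zip_map_map zip_same)
  then have "{u, v} \<in> E \<longleftrightarrow> {u, v} \<in> F" if "u < n" "v < n" for u v
    using that by (auto simp: map_eq_conv of_bool_eq_iff)
  then have "E = F"
    using assms(2,3) unfolding finite_simple_graph_def nm by blast
  moreover have V: "V' = W'"
    using parts(2) assms(4,5) unfolding nm by (auto simp: map_eq_conv of_bool_eq_iff)
  moreover have "\<forall>v\<in>V'. f' v = g' v"
  proof
    fix v assume "v \<in> V'"
    moreover from this have "v \<in> set [0..<n]" using assms(4) by auto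
    ultimately show "f' v = g' v"
      using parts(3) unfolding V[symmetric] map_eq_conv by (metis (full_types))
  qed
  ultimately show ?thesis using nm by blast
qed

definition lipschitz_extension_problem :: "int \<Rightarrow> int list set" where
  "lipschitz_extension_problem M =
     {encode_instance n E V' f' | n E V' f'.
        finite_simple_graph {..<n} E \<and> connected_graph {..<n} E \<and> V' \<subseteq> {..<n} \<and>
        (\<exists>f. lipschitz_mapping M {..<n} E f \<and> (\<forall>v\<in>V'. f v = f' v))}"

end

theory Submission
  imports Defs
begin

text \<open>
  By connectedness, an \<open>M\<close>-Lipschitz mapping that vanishes somewhere is bounded by \<open>M * L\<close>
  whenever \<open>L\<close> is at least the number of (directed) edges. Relaxing all edges \<open>L\<close> times, starting
  from the prescribed values and from \<open>M * L\<close> at the free vertices, gives the greatest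
  \<open>M\<close>-Lipschitz function \<open>g\<close> below these values; in the same way one obtains the least one \<open>h\<close>
  above the prescribed values and \<open>- M * L\<close>. Every solution lies between \<open>h\<close> and \<open>g\<close>.
  Conversely, if \<open>h \<le> g\<close> everywhere and \<open>h r \<le> 0 \<le> g r\<close> for some vertex \<open>r\<close>, then
  \<open>max h (min g 0)\<close> is a solution. Connectedness itself is a relaxation with step 0.

  Since the machine only adds and subtracts, each step lengthens the register contents by at
  most one bit, so a polynomial number of steps already has polynomial logarithmic cost. The
  program is written in a language with bounded loops whose running time can be read off
  syntactically, and compiled to the machine.
\<close>

section \<open>Step counts and logarithmic cost\<close>

text \<open>Two obstacles shape the development: the machine starts with the input filling its low
  registers, and it must answer correctly on every list of integers. The claimed number of vertices,
  by contrast, is a binary integer that may be exponential in the input size; it is cut off at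
  \<open>L\<close> before any loop uses it, and only then is the length compared with
  \<open>n * n + 2 * n + 1\<close>. As many rounds as there are edges suffice because a walk with
  more edges than the graph has can be shortened, and with a nonnegative step this never raises its
  value. The factor 64 exceeds the 32 low registers reserved for variables and scratch, so the block
  is out of their way even for a one-element input.\<close>

primrec reach :: "instr list \<Rightarrow> nat \<Rightarrow> config \<Rightarrow> config \<Rightarrow> bool" where
  "reach P 0 c c' \<longleftrightarrow> c = c'"
| "reach P (Suc t) c c' \<longleftrightarrow> fst c < length P \<and> reach P t (step (P ! fst c) c) c'"

lemma reach_trans:
  "reach P t c c' \<Longrightarrow> reach P t' c' c'' \<Longrightarrow> reach P (t + t') c c''"
  by (induction t arbitrary: c) auto

fun instr_args :: "instr \<Rightarrow> int list" where
  "instr_args (Const i c) = [int i, c]"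
| "instr_args (Copy i j) = [int i, int j]"
| "instr_args (Add i j k) = [int i, int j, int k]"
| "instr_args (Sub i j k) = [int i, int j, int k]"
| "instr_args (Load i j) = [int i, int j]"
| "instr_args (Store i j) = [int i, int j]"
| "instr_args (Jump l) = []"
| "instr_args (JumpPos i l) = [int i]"

definition instr_bound :: "nat \<Rightarrow> instr \<Rightarrow> bool" where
  "instr_bound b i \<longleftrightarrow> (\<forall>c\<in>set (instr_args i). \<bar>c\<bar> < 2 ^ b)"

lemma abs_less_power_mono: "\<bar>c :: int\<bar> < 2 ^ b \<Longrightarrow> b \<le> b' \<Longrightarrow> \<bar>c\<bar> < 2 ^ b'"
  by (meson order_less_le_trans one_le_numeral power_increasing)

text \<open>The program is fixed, so its finitely many constants add only a constant to the length
  of the register contents.\<close>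

lemma ex_instr_bound: "\<exists>b. \<forall>i\<in>set P. instr_bound b i"
proof -
  let ?cs = "concat (map instr_args P)"
  have "\<bar>c\<bar> < 2 ^ nat (sum_list (map abs ?cs))" if "c \<in> set ?cs" for c
  proof -
    have "\<bar>c\<bar> \<le> sum_list (map abs ?cs)"
      using that by (intro member_le_sum_list) auto
    then have "nat \<bar>c\<bar> \<le> nat (sum_list (map abs ?cs))" by (rule nat_mono)
    moreover have "int (nat \<bar>c\<bar>) < 2 ^ nat \<bar>c\<bar>" by (rule of_nat_less_two_power)
    then have "\<bar>c\<bar> < 2 ^ nat \<bar>c\<bar>" by simp
    ultimately show ?thesis by (rule abs_less_power_mono[rotated])
  qed
  then show ?thesis by (intro exI) (auto simp: instr_bound_def)
qed

lemma bits_le: "\<bar>z\<bar> < 2 ^ b \<Longrightarrow> bits z \<le> b + 1"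
proof -
  assume "\<bar>z\<bar> < 2 ^ b"
  then have "nat \<bar>z\<bar> < 2 ^ b" by (simp add: nat_less_iff)
  then have "floorlog 2 (nat \<bar>z\<bar>) \<le> b"
    by (intro floorlog_leI) auto
  then show ?thesis by (simp add: bits_def)
qed

lemma abs_less_bits: "\<bar>z\<bar> < 2 ^ bits z"
proof -
  have "nat \<bar>z\<bar> < 2 ^ floorlog 2 (nat \<bar>z\<bar>)"
    using floorlog_bounds[of "nat \<bar>z\<bar>" 2] by (cases "z = 0") auto
  then have "\<bar>z\<bar> < 2 ^ floorlog 2 (nat \<bar>z\<bar>)" by (simp add: nat_less_iff)
  then show ?thesis by (rule abs_less_power_mono) (simp add: bits_def)
qed

text \<open>An instruction is charged for at most three literals of its own and at most two register
  contents, hence the factor 5.\<close>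

lemma cost_le:
  assumes "instr_bound b i" and R: "\<forall>j. \<bar>R j\<bar> < 2 ^ b"
  shows "cost i R \<le> 5 * (b + 1)"
proof -
  have *: "bits (R j) \<le> b + 1" for j using R bits_le by blast
  have *: "bits (R j) \<le> 2 * (b + 1)" "bits (R j) + bits (R k) \<le> 2 * (b + 1)" for j k
    using *[of j] *[of k] by auto
  have **: "bits c \<le> b + 1" if "c \<in> set (instr_args i)" for c
    using that assms(1) bits_le by (auto simp: instr_bound_def)
  have "cost i R \<le> sum_list (map bits (instr_args i)) + 2 * (b + 1)"
    using * by (cases i) (simp_all del: mult_Suc_right)
  moreover have "sum_list (map bits l) \<le> length l * (b + 1)"
    if "\<And>c. c \<in> set l \<Longrightarrow> bits c \<le> b + 1" for l
    using that by (induction l) fastforce+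
  then have "sum_list (map bits (instr_args i)) \<le> length (instr_args i) * (b + 1)"
    using ** by blast
  moreover have "length (instr_args i) * (b + 1) \<le> 3 * (b + 1)"
    by (intro mult_le_mono1) (cases i; simp)
  ultimately show ?thesis by simp
qed

lemma step_bound:
  assumes "instr_bound b i" and R: "\<forall>j. \<bar>R j\<bar> < 2 ^ b"
  shows "\<bar>snd (step i (pc, R)) j\<bar> < 2 ^ Suc b"
proof -
  have *: "\<bar>R j\<bar> < 2 ^ b" for j using R by blast
  have "(0::int) < 2 ^ b" by simp
  moreover have "\<bar>R j + R k\<bar> < 2 * 2 ^ b" "\<bar>R j - R k\<bar> < 2 * 2 ^ b"  "\<bar>R j\<bar> < 2 * 2 ^ b" for j k
    using *[of j] *[of k] by linarith+
  ultimately show ?thesis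
    using assms(1) by (cases i) (auto simp: instr_bound_def)
qed

text \<open>By \<open>step_bound\<close> the exponent \<open>b\<close> grows by one per instruction,
  so it stays at most \<open>b + t\<close> throughout. From here on it is enough to count
  instructions.\<close>

lemma exec_of_reach:
  assumes "\<forall>i\<in>set P. instr_bound b i" and "\<forall>j. \<bar>R j\<bar> < 2 ^ b"
    and "reach P t (pc, R) (pc', R')" and "length P \<le> pc'"
  shows "\<exists>w. exec P (pc, R) w R' \<and> w \<le> t * (5 * (b + t + 1))"
  using assms
proof (induction t arbitrary: b pc R)
  case 0
  then show ?case by (auto intro: exec.halt)
next
  case (Suc t)
  let ?c = "step (P ! pc) (pc, R)"
  have pc: "pc < length P" and r: "reach P t (fst ?c, snd ?c) (pc', R')"
    using Suc.prems(3) by auto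
  have i: "instr_bound b (P ! pc)" using Suc.prems(1) pc by simp
  have "\<forall>i\<in>set P. instr_bound (Suc b) i"
    using Suc.prems(1)
    by (auto simp: instr_bound_def simp del: power_Suc intro: abs_less_power_mono[OF _ le_SucI])
  moreover have "\<forall>j. \<bar>snd ?c j\<bar> < 2 ^ Suc b"
    using step_bound[OF i Suc.prems(2)] by blast
  ultimately obtain w where w: "exec P (fst ?c, snd ?c) w R'" "w \<le> t * (5 * (Suc b + t + 1))"
    using Suc.IH r Suc.prems(4) by blast
  have "exec P (pc, R) (cost (P ! pc) R + w) R'"
    using exec.step[OF pc] w(1) by simp
  moreover have "cost (P ! pc) R + w \<le> Suc t * (5 * (b + Suc t + 1))"
    using cost_le[OF i Suc.prems(2)] w(2) by (simp add: algebra_simps)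
  ultimately show ?case by blast
qed


section \<open>A language with bounded loops\<close>

datatype var = rLim | rOne | rN | rAdj | rDom | rVal | rC | rG | rH | rM | rZero | rBound
  | rBad | rFound | rSq | rRound | rU | rV | rCnt | rAddr | rA | rB | rT | rX

primrec reg :: "var \<Rightarrow> nat" where
  "reg rLim = 0" | "reg rOne = 1" | "reg rN = 2" | "reg rAdj = 3" | "reg rDom = 4"
| "reg rVal = 5" | "reg rC = 6" | "reg rG = 7" | "reg rH = 8" | "reg rM = 9"
| "reg rZero = 10" | "reg rBound = 11" | "reg rBad = 12" | "reg rFound = 13" | "reg rSq = 14"
| "reg rRound = 15" | "reg rU = 16" | "reg rV = 17" | "reg rCnt = 18" | "reg rAddr = 19"
| "reg rA = 20" | "reg rB = 21" | "reg rT = 22" | "reg rX = 23"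

lemma reg_less: "reg x < 31"
  by (cases x) auto

text \<open>An explicit left inverse of \<open>reg\<close>; injectivity follows without comparing
  all pairs of variables.\<close>

lemma reg_decode:
  "[rLim, rOne, rN, rAdj, rDom, rVal, rC, rG, rH, rM, rZero, rBound, rBad, rFound, rSq, rRound,
    rU, rV, rCnt, rAddr, rA, rB, rT, rX] ! reg x = x"
  by (cases x) simp_all

lemma reg_inj: "reg x = reg y \<longleftrightarrow> x = y"
  by (metis reg_decode)

text \<open>Separate constructors rule out aliasing: a store to a computed heap address cannot
  change a variable.\<close>

datatype loc = V var | H nat

type_synonym state = "loc \<Rightarrow> int"

datatype com =
    CSkip
  | CConst var int
  | CCopy var var
  | CAdd var var var
  | CSub var var var
  | CLoad var var
  | CStore var var
  | CSeq com com (infixr \<open>;;\<close> 60)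
  | CIf var com com
  | CLoop var var com

text \<open>
  In \<open>CLoop x y c\<close> the counter \<open>x\<close> runs downwards through \<open>y - 1, ..., 0\<close>;
  \<open>foldr\<close> processes its list from the right.
\<close>

primrec sem :: "com \<Rightarrow> state \<Rightarrow> state" where
  "sem CSkip s = s"
| "sem (CConst x c) s = s(V x := c)"
| "sem (CCopy x y) s = s(V x := s (V y))"
| "sem (CAdd x y z) s = s(V x := s (V y) + s (V z))"
| "sem (CSub x y z) s = s(V x := s (V y) - s (V z))"
| "sem (CLoad x y) s = s(V x := s (H (nat (s (V y)))))"
| "sem (CStore x y) s = s(H (nat (s (V x))) := s (V y))"
| "sem (c1 ;; c2) s = sem c2 (sem c1 s)"
| "sem (CIf x c1 c2) s = (if s (V x) > 0 then sem c1 s else sem c2 s)"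
| "sem (CLoop x y c) s =
     foldr (\<lambda>i s. sem c (s(V x := int i))) [0..<nat (s (V y))] (s(V x := s (V y)))"

text \<open>
  \<open>loops_bounded K c\<close>: the command does not write the variables in \<open>K\<close>, and every loop bound is in \<open>K\<close>
  or an enclosing loop counter. Thus the number of iterations of each loop is at most the
  maximum of the initial values of the variables in \<open>K\<close>.
\<close>

primrec loops_bounded :: "var set \<Rightarrow> com \<Rightarrow> bool" where
  "loops_bounded K CSkip \<longleftrightarrow> True"
| "loops_bounded K (CConst x c) \<longleftrightarrow> x \<notin> K"
| "loops_bounded K (CCopy x y) \<longleftrightarrow> x \<notin> K"
| "loops_bounded K (CAdd x y z) \<longleftrightarrow> x \<notin> K"
| "loops_bounded K (CSub x y z) \<longleftrightarrow> x \<notin> K"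
| "loops_bounded K (CLoad x y) \<longleftrightarrow> x \<notin> K"
| "loops_bounded K (CStore x y) \<longleftrightarrow> True"
| "loops_bounded K (c1 ;; c2) \<longleftrightarrow> loops_bounded K c1 \<and> loops_bounded K c2"
| "loops_bounded K (CIf x c1 c2) \<longleftrightarrow> loops_bounded K c1 \<and> loops_bounded K c2"
| "loops_bounded K (CLoop x y c) \<longleftrightarrow> y \<in> K \<and> x \<notin> K \<and> loops_bounded (insert x K) c"

text \<open>The argument is a common bound on all loop counts. Both branches of a conditional are
  charged, so that no test has to be evaluated. A loop pays 3 for its initial copy and its exit, and
  4 per round for test, constant, decrement and back jump.\<close>

primrec time_poly :: "com \<Rightarrow> nat poly" where
  "time_poly CSkip = 0"
| "time_poly (CConst x c) = [:1:]"
| "time_poly (CCopy x y) = [:1:]"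
| "time_poly (CAdd x y z) = [:1:]"
| "time_poly (CSub x y z) = [:1:]"
| "time_poly (CLoad x y) = [:5:]"
| "time_poly (CStore x y) = [:5:]"
| "time_poly (c1 ;; c2) = time_poly c1 + time_poly c2"
| "time_poly (CIf x c1 c2) = [:2:] + time_poly c1 + time_poly c2"
| "time_poly (CLoop x y c) = [:3:] + [:0, 1:] * ([:4:] + time_poly c)"

primrec csize :: "com \<Rightarrow> nat" where
  "csize CSkip = 0"
| "csize (CConst x c) = 1"
| "csize (CCopy x y) = 1"
| "csize (CAdd x y z) = 1"
| "csize (CSub x y z) = 1"
| "csize (CLoad x y) = 5"
| "csize (CStore x y) = 5"
| "csize (c1 ;; c2) = csize c1 + csize c2"
| "csize (CIf x c1 c2) = 2 + csize c1 + csize c2"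
| "csize (CLoop x y c) = 6 + csize c"

text \<open>
  The argument \<open>k\<close> is the address of the first instruction. Register 31 is scratch, and
  heap cell \<open>a\<close> lives in register \<open>32 + a\<close>. As \<open>sem\<close> reads a negative heap address as 0, the
  code for \<open>CLoad\<close> and \<open>CStore\<close> only adds positive addresses to 32, so that the heap can never
  overwrite a variable.
\<close>

primrec compile :: "nat \<Rightarrow> com \<Rightarrow> instr list" where
  "compile k CSkip = []"
| "compile k (CConst x c) = [Const (reg x) c]"
| "compile k (CCopy x y) = [Copy (reg x) (reg y)]"
| "compile k (CAdd x y z) = [Add (reg x) (reg y) (reg z)]"
| "compile k (CSub x y z) = [Sub (reg x) (reg y) (reg z)]"
| "compile k (CLoad x y) =
     [Const 31 32, JumpPos (reg y) (k + 3), Jump (k + 4), Add 31 31 (reg y), Load (reg x) 31]"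
| "compile k (CStore x y) =
     [Const 31 32, JumpPos (reg x) (k + 3), Jump (k + 4), Add 31 31 (reg x), Store 31 (reg y)]"
| "compile k (c1 ;; c2) = compile k c1 @ compile (k + csize c1) c2"
| "compile k (CIf x c1 c2) =
     JumpPos (reg x) (k + 2 + csize c2) # compile (k + 1) c2 @
     Jump (k + 2 + csize c2 + csize c1) # compile (k + 2 + csize c2) c1"
| "compile k (CLoop x y c) =
     Copy (reg x) (reg y) # JumpPos (reg x) (k + 3) # Jump (k + 6 + csize c) #
     Const 31 1 # Sub (reg x) (reg x) 31 # compile (k + 5) c @ [Jump (k + 1)]"

section \<open>Correctness and running time of the compiled code\<close>

lemma length_comp: "length (compile k c) = csize c"
  by (induction c arbitrary: k) auto

text \<open>\<open>foldr\<close> consumes the list from its right end, so the index runs down: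
  \<open>I k\<close> describes the state once the counter values from \<open>k\<close> upwards have
  been processed.\<close>

lemma foldr_upt_invariant:
  assumes "\<And>k s. k < n \<Longrightarrow> I (Suc k) s \<Longrightarrow> I k (f k s)" and "I n s"
  shows "I 0 (foldr f [0..<n] s)"
  using assms
proof (induction n arbitrary: s)
  case (Suc n)
  then show ?case by (simp add: Suc.IH)
qed simp

lemma sem_readonly: "loops_bounded K c \<Longrightarrow> x \<in> K \<Longrightarrow> sem c s (V x) = s (V x)"
proof (induction c arbitrary: K s)
  case (CLoop y z c)
  let ?I = "\<lambda>k t. t (V x) = s (V x)"
  have "?I 0 (foldr (\<lambda>i s. sem c (s(V y := int i))) [0..<nat (s (V z))] (s(V y := s (V z))))"
    by (rule foldr_upt_invariant[where I = ?I]) (use CLoop in auto)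
  then show ?case by simp
qed auto

primrec code_at :: "instr list \<Rightarrow> nat \<Rightarrow> instr list \<Rightarrow> bool" where
  "code_at P k [] \<longleftrightarrow> True"
| "code_at P k (i # is) \<longleftrightarrow> k < length P \<and> P ! k = i \<and> code_at P (Suc k) is"

lemma code_at_append: "code_at P k (l @ l') \<longleftrightarrow> code_at P k l \<and> code_at P (k + length l) l'"
  by (induction l arbitrary: k) auto

lemma code_at_self: "code_at (P @ Q) (length P) Q"
proof (induction Q arbitrary: P)
  case (Cons i Q)
  then show ?case using Cons.IH[of "P @ [i]"] by (simp add: nth_append)
qed simp

definition represents :: "registers \<Rightarrow> state \<Rightarrow> bool" where
  "represents R s \<longleftrightarrow> (\<forall>x. R (reg x) = s (V x)) \<and> (\<forall>a. R (32 + a) = s (H a))"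

lemma represents_reg: "represents R s \<Longrightarrow> R (reg x) = s (V x)"
  by (simp add: represents_def)

lemma represents_heap: "represents R s \<Longrightarrow> R (32 + a) = s (H a)"
  by (simp add: represents_def)

lemma reg_neq:
  fixes x :: var
  shows "reg x \<noteq> 31" "31 \<noteq> reg x" "reg x \<noteq> 32 + a" "32 + a \<noteq> reg x"
  using reg_less[of x] by auto

lemma represents_upd_var: "represents R s \<Longrightarrow> represents (R(reg x := c)) (s(V x := c))"
  using reg_neq by (auto simp: represents_def reg_inj)

lemma represents_upd_heap: "represents R s \<Longrightarrow> represents (R(32 + a := c)) (s(H a := c))"
  using reg_neq by (auto simp: represents_def)

lemma represents_upd_scratch: "represents R s \<Longrightarrow> represents (R(31 := c)) s"
  using reg_neq by (auto simp: represents_def)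

lemma small_numerals:
  "(2 :: nat) = Suc (Suc 0)" "(3 :: nat) = Suc (Suc (Suc 0))"
  "(4 :: nat) = Suc (Suc (Suc (Suc 0)))" "(5 :: nat) = Suc (Suc (Suc (Suc (Suc 0))))"
  "(6 :: nat) = Suc (Suc (Suc (Suc (Suc (Suc 0)))))"
  by simp_all

lemma reach_address:
  assumes "code_at P k [Const 31 32, JumpPos (reg x) (k + 3), Jump (k + 4), Add 31 31 (reg x)]"
    and "represents R s"
  shows "\<exists>t\<le>4. reach P t (k, R) (k + 4, R(31 := int (32 + nat (s (V x)))))"
proof -
  have "R (reg x) = s (V x)" using assms(2) by (rule represents_reg)
  \<comment> \<open>Both outcomes of the test take three instructions: either \<open>Jump\<close>
    skips the addition, or the conditional jump leads to it.\<close>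
  then have "reach P 3 (k, R) (k + 4, R(31 := int (32 + nat (s (V x)))))"
    using assms(1) reg_neq(1,2)[of x]
    by (cases "s (V x) > 0") (simp_all add: small_numerals)
  then show ?thesis by (intro exI[of _ 3]) simp
qed

text \<open>Induction on the command for all \<open>K\<close> at once: in a loop body the counter
  joins \<open>K\<close>, and it respects the bound \<open>N\<close> because its values lie below
  the loop bound, itself the value of a variable in \<open>K\<close>.\<close>

lemma comp_correct:
  assumes "loops_bounded K c" and "\<forall>x\<in>K. s (V x) \<le> int N"
    and "code_at P k (compile k c)" and "represents R s"
  shows "\<exists>t R'. reach P t (k, R) (k + csize c, R') \<and> represents R' (sem c s) \<and>
    t \<le> poly (time_poly c) N"
  using assms
proof (induction c arbitrary: K s k R)
  case CSkip
  then show ?case by (auto intro!: exI[of _ 0])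
next
  case (CConst x c)
  have "represents (R(reg x := c)) (sem (CConst x c) s)"
    using represents_upd_var[OF CConst.prems(4)] by simp
  moreover have "reach P 1 (k, R) (k + 1, R(reg x := c))"
    using CConst.prems(3) by simp
  ultimately show ?case
    by (intro exI[of _ 1] exI[of _ "R(reg x := c)"] conjI) (simp_all add: fun_upd_def)
next
  case (CCopy x y)
  have "represents (R(reg x := s (V y))) (sem (CCopy x y) s)"
    using represents_upd_var[OF CCopy.prems(4)] by simp
  moreover have "reach P 1 (k, R) (k + 1, R(reg x := s (V y)))"
    using CCopy.prems(3) represents_reg[OF CCopy.prems(4)] by simp
  ultimately show ?case
    by (intro exI[of _ 1] exI[of _ "R(reg x := s (V y))"] conjI) (simp_all add: fun_upd_def)
next
  case (CAdd x y z)
  have "represents (R(reg x := s (V y) + s (V z))) (sem (CAdd x y z) s)"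
    using represents_upd_var[OF CAdd.prems(4)] by simp
  moreover have "reach P 1 (k, R) (k + 1, R(reg x := s (V y) + s (V z)))"
    using CAdd.prems(3) represents_reg[OF CAdd.prems(4)] by simp
  ultimately show ?case
    by (intro exI[of _ 1] exI[of _ "R(reg x := s (V y) + s (V z))"] conjI) (simp_all add: fun_upd_def)
next
  case (CSub x y z)
  have "represents (R(reg x := s (V y) - s (V z))) (sem (CSub x y z) s)"
    using represents_upd_var[OF CSub.prems(4)] by simp
  moreover have "reach P 1 (k, R) (k + 1, R(reg x := s (V y) - s (V z)))"
    using CSub.prems(3) represents_reg[OF CSub.prems(4)] by simp
  ultimately show ?case
    by (intro exI[of _ 1] exI[of _ "R(reg x := s (V y) - s (V z))"] conjI) (simp_all add: fun_upd_def)
next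
  case (CLoad x y)
  let ?a = "nat (s (V y))"
  let ?R = "R(31 := int (32 + ?a))"
  obtain t where t: "t \<le> 4" "reach P t (k, R) (k + 4, ?R)"
    using reach_address[of P k y R s] CLoad.prems(3,4) by auto
  have "represents ?R s" using CLoad.prems(4) by (rule represents_upd_scratch)
  then have "represents (?R(reg x := s (H ?a))) (sem (CLoad x y) s)"
    using represents_upd_var by simp
  moreover have "nat (int (32 + ?a)) = 32 + ?a" by (rule nat_int)
  then have "reach P 1 (k + 4, ?R) (k + 5, ?R(reg x := s (H ?a)))"
    using CLoad.prems(3) represents_heap[OF CLoad.prems(4)] reg_neq(1,2)[of y]
    by (simp add: small_numerals)
  from reach_trans[OF t(2) this] have "reach P (t + 1) (k, R) (k + 5, ?R(reg x := s (H ?a)))" .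
  ultimately show ?case using t(1)
    by (intro exI[of _ "t + 1"] exI[of _ "?R(reg x := s (H ?a))"] conjI) (simp_all add: fun_upd_def)
next
  case (CStore x y)
  let ?a = "nat (s (V x))"
  let ?R = "R(31 := int (32 + ?a))"
  obtain t where t: "t \<le> 4" "reach P t (k, R) (k + 4, ?R)"
    using reach_address[of P k x R s] CStore.prems(3,4) by auto
  have "represents ?R s" using CStore.prems(4) by (rule represents_upd_scratch)
  then have "represents (?R(32 + ?a := s (V y))) (sem (CStore x y) s)"
    using represents_upd_heap by simp
  moreover have "nat (int (32 + ?a)) = 32 + ?a" by (rule nat_int)
  then have "reach P 1 (k + 4, ?R) (k + 5, ?R(32 + ?a := s (V y)))"
    using CStore.prems(3) represents_reg[OF CStore.prems(4)] reg_neq(1,2)[of y]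
    by (simp add: small_numerals)
  from reach_trans[OF t(2) this] have "reach P (t + 1) (k, R) (k + 5, ?R(32 + ?a := s (V y)))" .
  ultimately show ?case using t(1)
    by (intro exI[of _ "t + 1"] exI[of _ "?R(32 + ?a := s (V y))"] conjI) (simp_all add: fun_upd_def)
next
  case (CSeq c1 c2)
  obtain t R' where 1: "reach P t (k, R) (k + csize c1, R')" "represents R' (sem c1 s)"
    "t \<le> poly (time_poly c1) N"
    using CSeq.IH(1)[of K s k R] CSeq.prems by (auto simp: code_at_append)
  have "\<forall>x\<in>K. sem c1 s (V x) \<le> int N"
    using CSeq.prems(1,2) sem_readonly[of K c1] by auto
  then obtain t' R'' where 2: "reach P t' (k + csize c1, R') (k + csize c1 + csize c2, R'')"
    "represents R'' (sem c2 (sem c1 s))" "t' \<le> poly (time_poly c2) N"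
    using CSeq.IH(2)[of K "sem c1 s" "k + csize c1" R'] CSeq.prems 1
    by (auto simp: code_at_append length_comp)
  show ?case using reach_trans[OF 1(1) 2(1)] 1(3) 2(2,3)
    by (intro exI[of _ "t + t'"] exI[of _ R''] conjI) (simp_all add: add.assoc)
next
  case (CIf x c1 c2)
  let ?k = "k + 2 + csize c2"
  have code: "k < length P" "P ! k = JumpPos (reg x) ?k" "code_at P (k + 1) (compile (k + 1) c2)"
    "k + 1 + csize c2 < length P" "P ! (k + 1 + csize c2) = Jump (?k + csize c1)"
    "code_at P ?k (compile ?k c1)"
    using CIf.prems(3) by (auto simp: code_at_append length_comp)
  show ?case
  proof (cases "s (V x) > 0")
    case True
    obtain t R' where 1: "reach P t (?k, R) (?k + csize c1, R')" "represents R' (sem c1 s)"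
      "t \<le> poly (time_poly c1) N"
      using CIf.IH(1)[of K s ?k R] CIf.prems code by auto
    have "reach P (Suc t) (k, R) (?k + csize c1, R')"
      using 1(1) code(1,2) True CIf.prems(4) by (simp add: represents_reg)
    then show ?thesis using 1 True
      by (intro exI[of _ "Suc t"] exI[of _ R'] conjI) (simp_all add: ac_simps)
  next
    case False
    obtain t R' where 1: "reach P t (k + 1, R) (k + 1 + csize c2, R')" "represents R' (sem c2 s)"
      "t \<le> poly (time_poly c2) N"
      using CIf.IH(2)[of K s "k + 1" R] CIf.prems code by auto
    have "reach P (Suc t) (k, R) (k + 1 + csize c2, R')"
      using 1(1) code(1,2) False CIf.prems(4) by (simp add: represents_reg)
    moreover have "reach P 1 (k + 1 + csize c2, R') (?k + csize c1, R')"
      using code(4,5) by simp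
    ultimately have "reach P (Suc t + 1) (k, R) (?k + csize c1, R')"
      by (rule reach_trans)
    then show ?thesis using 1 False
      by (intro exI[of _ "Suc t + 1"] exI[of _ R'] conjI) (simp_all add: ac_simps)
  qed
next
  case (CLoop x y c)
  let ?f = "\<lambda>i s. sem c (s(V x := int i))" and ?T = "poly (time_poly c) N"
    and ?end = "k + 6 + csize c"
  have y: "y \<in> K" and x: "x \<notin> K" and c: "loops_bounded (insert x K) c"
    using CLoop.prems(1) by auto
  have code: "k < length P" "P ! k = Copy (reg x) (reg y)"
    "k + 1 < length P" "P ! (k + 1) = JumpPos (reg x) (k + 3)"
    "k + 2 < length P" "P ! (k + 2) = Jump ?end"
    "k + 3 < length P" "P ! (k + 3) = Const 31 1"
    "k + 4 < length P" "P ! (k + 4) = Sub (reg x) (reg x) 31"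
    "code_at P (k + 5) (compile (k + 5) c)"
    "k + 5 + csize c < length P" "P ! (k + 5 + csize c) = Jump (k + 1)"
    using CLoop.prems(3) by (simp_all add: code_at_append length_comp small_numerals)
  have loop: "\<exists>t R'. reach P t (k + 1, R) (?end, R') \<and> represents R' (foldr ?f [0..<m] s) \<and>
      t \<le> m * (4 + ?T) + 2"
    if "represents R s" "m = nat (s (V x))" "\<forall>x\<in>K. s (V x) \<le> int N" "m \<le> N" for m R s
    using that
  proof (induction m arbitrary: R s)
    case 0
    then have "reach P 2 (k + 1, R) (?end, R)"
      using code(3-6) by (simp add: small_numerals represents_reg)
    with 0 show ?case by (intro exI[of _ 2] exI[of _ R]) auto
  next
    case (Suc m)
    have sx: "s (V x) = 1 + int m" using Suc.prems(2) by linarith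
    let ?s = "s(V x := int m)" and ?R = "R(31 := 1, reg x := int m)"
    have "reach P 3 (k + 1, R) (k + 5, ?R)"
      using code(3-10) sx Suc.prems(1) reg_neq(1,2)[of x]
      by (simp add: small_numerals represents_reg)
    moreover have rep: "represents ?R ?s"
      using Suc.prems(1) by (intro represents_upd_var represents_upd_scratch)
    have K: "\<forall>z\<in>insert x K. ?s (V z) \<le> int N"
      using Suc.prems(3,4) by auto
    obtain t R' where 1: "reach P t (k + 5, ?R) (k + 5 + csize c, R')"
      "represents R' (sem c ?s)" "t \<le> ?T"
      using CLoop.IH[OF c K code(11) rep] by blast
    moreover have "reach P 1 (k + 5 + csize c, R') (k + 1, R')"
      using code(12,13) by simp
    ultimately have a: "reach P (3 + (t + 1)) (k + 1, R) (k + 1, R')"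
      by (metis reach_trans)
    have eq: "sem c ?s (V z) = ?s (V z)" if "z \<in> insert x K" for z
      using sem_readonly[OF c that] .
    then have "m = nat (sem c ?s (V x))" "\<forall>z\<in>K. sem c ?s (V z) \<le> int N" "m \<le> N"
      using x Suc.prems(3,4) by auto
    then obtain t' R'' where 2: "reach P t' (k + 1, R') (?end, R'')"
      "represents R'' (foldr ?f [0..<m] (sem c ?s))" "t' \<le> m * (4 + ?T) + 2"
      using Suc.IH[OF 1(2)] by blast
    show ?case using reach_trans[OF a 2(1)] 1(3) 2(2,3)
      by (intro exI[of _ "3 + (t + 1) + t'"] exI[of _ R'']) (auto simp: fun_upd_def)
  qed
  let ?s = "s(V x := s (V y))" and ?R = "R(reg x := s (V y))"
  have n: "nat (s (V y)) \<le> N" using y CLoop.prems(2) by auto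
  have rep: "represents ?R ?s" using CLoop.prems(4) by (rule represents_upd_var)
  have "nat (s (V y)) = nat (?s (V x))" "\<forall>z\<in>K. ?s (V z) \<le> int N"
    using x CLoop.prems(2) by auto
  then obtain t R' where t: "reach P t (k + 1, ?R) (?end, R')"
    "represents R' (foldr ?f [0..<nat (s (V y))] ?s)" "t \<le> nat (s (V y)) * (4 + ?T) + 2"
    using loop[OF rep] n by blast
  have "t \<le> N * (4 + ?T) + 2"
    by (rule order_trans[OF t(3) add_le_mono1[OF mult_le_mono1[OF n]]])
  then have "Suc t \<le> poly (time_poly (CLoop x y c)) N" by simp
  moreover have "reach P (Suc t) (k, R) (?end, R')"
    using t(1) code(1,2) CLoop.prems(4) by (simp add: represents_reg)
  moreover have "represents R' (sem (CLoop x y c) s)" using t(2) by simp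
  moreover have "k + csize (CLoop x y c) = ?end" by simp
  ultimately show ?case by metis
qed


section \<open>Relaxation\<close>

text \<open>
  The folds run from the right, in the order in which the loops of the program count down.
\<close>

definition relax :: "(nat \<Rightarrow> nat \<Rightarrow> bool) \<Rightarrow> int \<Rightarrow> nat \<Rightarrow> nat \<Rightarrow> (nat \<Rightarrow> int) \<Rightarrow> nat \<Rightarrow> int" where
  "relax adj d u v x = (if adj u v \<and> x u + d < x v then x(v := x u + d) else x)"

text \<open>A round of Bellman-Ford with updates in place. A pair treated late already sees values
  lowered in the same round, so walks with more edges than rounds can contribute;
  \<open>sweeps_greatest\<close> has to allow for them.\<close>

definition sweep :: "nat \<Rightarrow> (nat \<Rightarrow> nat \<Rightarrow> bool) \<Rightarrow> int \<Rightarrow> (nat \<Rightarrow> int) \<Rightarrow> nat \<Rightarrow> int" where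
  "sweep n adj d = foldr (\<lambda>u. foldr (\<lambda>v. relax adj d u v) [0..<n]) [0..<n]"

lemma foldr_pairs:
  "foldr (\<lambda>u. foldr (f u) vs) us = foldr (\<lambda>(u, v). f u v) (List.product us vs)"
proof (induction us)
  case (Cons u us)
  have "foldr (\<lambda>(u, v). f u v) (map (Pair u) vs) = foldr (f u) vs"
    by (induction vs) simp_all
  with Cons show ?case by (simp add: comp_def)
qed simp

lemma foldr_relax_le: "foldr (\<lambda>(u, v). relax adj d u v) ps x w \<le> x w"
  by (induction ps) (auto simp: relax_def split: prod.splits intro: order_trans)

text \<open>Values never rise. When \<open>(u, v)\<close> is treated, the value at \<open>u\<close>
  is at most \<open>x u\<close>, so the value at \<open>v\<close> becomes at most
  \<open>x u + d\<close>, and later pairs can only lower it.\<close>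

lemma foldr_relax_edge:
  "(u, v) \<in> set ps \<Longrightarrow> adj u v \<Longrightarrow> 0 \<le> d \<Longrightarrow>
   foldr (\<lambda>(u, v). relax adj d u v) ps x v \<le> x u + d"
proof (induction ps)
  case (Cons p ps)
  define y where "y = foldr (\<lambda>(u, v). relax adj d u v) ps x"
  obtain a b where p: "p = (a, b)" by force
  have "relax adj d a b y v \<le> x u + d"
  proof (cases "p = (u, v)")
    case True
    moreover have "y u \<le> x u" unfolding y_def by (rule foldr_relax_le)
    ultimately show ?thesis using Cons.prems p by (auto simp: relax_def)
  next
    case False
    then have "y v \<le> x u + d" using Cons by (simp add: y_def)
    then show ?thesis by (auto simp: relax_def)
  qed
  then show ?case by (simp add: p y_def)
qed simp

lemma sweep_eq: "sweep n adj d = foldr (\<lambda>(u, v). relax adj d u v) (List.product [0..<n] [0..<n])"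
  unfolding sweep_def by (rule foldr_pairs)

lemma sweep_invariant:
  assumes "\<And>u v x. u < n \<Longrightarrow> v < n \<Longrightarrow> I x \<Longrightarrow> I (relax adj d u v x)" and "I x"
  shows "I (sweep n adj d x)"
proof -
  have *: "I (foldr (\<lambda>(u, v). relax adj d u v) ps x)" if "set ps \<subseteq> {..<n} \<times> {..<n}" for ps
    using that by (induction ps) (auto intro: assms)
  show ?thesis unfolding sweep_eq by (rule *) auto
qed

text \<open>Extending a walk of at most \<open>T\<close> edges by one edge may exceed
  \<open>T\<close>; then a walk of at most \<open>card r\<close> edges replaces it. The bound
  \<open>j \<le> Suc k\<close> records that the replacement is not longer, hence not more
  expensive.\<close>

lemma relpow_shorten:
  fixes r :: "('a \<times> 'a) set"
  assumes "finite r" and "card r \<le> T" and "p \<in> r ^^ Suc k" and "k \<le> T"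
  shows "\<exists>j\<le>T. j \<le> Suc k \<and> p \<in> r ^^ j"
proof (cases "Suc k \<le> T")
  case True
  with assms show ?thesis by blast
next
  case False
  have "p \<in> r\<^sup>*" using assms(3) relpow_imp_rtrancl by blast
  then obtain j where "j \<le> card r" "p \<in> r ^^ j"
    using rtrancl_finite_eq_relpow[OF assms(1)] by auto
  with assms(2,4) False show ?thesis by (intro exI[of _ j]) auto
qed

text \<open>
  After \<open>T\<close> rounds the value at \<open>v\<close> is the minimum of \<open>x0 u + k d\<close> over all walks of length
  \<open>k \<le> T\<close> from some \<open>u\<close> to \<open>v\<close>.
\<close>

lemma sweeps_greatest:
  fixes n :: nat and adj :: "nat \<Rightarrow> nat \<Rightarrow> bool"
  defines "r \<equiv> {(u, v). u < n \<and> v < n \<and> adj u v}"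
  assumes d: "0 \<le> d" and T: "card r \<le> T" and x: "x = (sweep n adj d ^^ T) x0"
  shows "\<And>v. x v \<le> x0 v"
    and "\<And>u v. (u, v) \<in> r \<Longrightarrow> x v \<le> x u + d"
    and "\<And>y v. (\<forall>v<n. y v \<le> x0 v) \<Longrightarrow> (\<forall>(u, v)\<in>r. y v \<le> y u + d) \<Longrightarrow> v < n \<Longrightarrow> y v \<le> x v"
proof -
  have fin: "finite r"
    by (rule finite_subset[of _ "{..<n} \<times> {..<n}"]) (auto simp: r_def)
  have step_le: "sweep n adj d y v \<le> y v" for y v
    unfolding sweep_eq by (rule foldr_relax_le)
  \<comment> \<open>The last round relaxes the last edge of the walk; the earlier rounds have
    accounted for the other edges.\<close>
  have upper: "(sweep n adj d ^^ t) x0 v \<le> x0 u + int k * d" if "(u, v) \<in> r ^^ k" "k \<le> t" for t u v k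
    using that
  proof (induction t arbitrary: v k)
    case 0
    then show ?case by simp
  next
    case (Suc t)
    show ?case
    proof (cases "k \<le> t")
      case True
      then show ?thesis using Suc.IH[OF Suc.prems(1)] step_le[of "(sweep n adj d ^^ t) x0" v]
        by (simp add: order_trans)
    next
      case False
      then have k: "k = Suc t" using Suc.prems(2) by simp
      then obtain w where w: "(u, w) \<in> r ^^ t" "(w, v) \<in> r" using Suc.prems(1) by auto
      have "sweep n adj d y v \<le> y w + d" for y
        unfolding sweep_eq using w(2) d by (intro foldr_relax_edge) (auto simp: r_def)
      from this[of "(sweep n adj d ^^ t) x0"] Suc.IH[OF w(1)] k
      show ?thesis by (simp add: algebra_simps)
    qed
  qed
  \<comment> \<open>For the opposite inequality \<open>k\<close> is left unbounded, since updates in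
    place may chain several edges within one round.\<close>
  define walk where "walk x \<longleftrightarrow> (\<forall>v<n. \<exists>u k. (u, v) \<in> r ^^ k \<and> x v = x0 u + int k * d)"
    for x
  have relax_walk: "walk (relax adj d u v y)" if uv: "u < n" "v < n" and y: "walk y" for u v y
  proof (cases "adj u v \<and> y u + d < y v")
    case True
    obtain w k where w: "(w, u) \<in> r ^^ k" "y u = x0 w + int k * d" using uv(1) y unfolding walk_def by blast
    have "(w, v) \<in> r ^^ Suc k" using w(1) True uv by (auto simp: r_def)
    moreover have "y u + d = x0 w + int (Suc k) * d" using w(2) by (simp add: algebra_simps)
    ultimately have "\<exists>w k. (w, v) \<in> r ^^ k \<and> y u + d = x0 w + int k * d" by blast
    with True y show ?thesis by (simp add: relax_def walk_def)
  next
    case False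
    then have "relax adj d u v y = y" by (auto simp: relax_def)
    with y show ?thesis by simp
  qed
  have walk: "walk ((sweep n adj d ^^ t) x0)" for t
  proof (induction t)
    case 0
    have "(v, v) \<in> r ^^ 0 \<and> x0 v = x0 v + int 0 * d" for v by simp
    then show ?case unfolding walk_def funpow_0 by blast
  next
    case (Suc t)
    have "walk (sweep n adj d ((sweep n adj d ^^ t) x0))"
      by (rule sweep_invariant[where I = walk]) (fact relax_walk, fact Suc.IH)
    then show ?case by simp
  qed
  show "x v \<le> x0 v" for v
    using upper[of v v 0 T] by (simp add: x)
  \<comment> \<open>A walk longer than \<open>T\<close> is shortened to at most
    \<open>card r\<close> edges, which by \<open>0 \<le> d\<close> does not increase its
    value.\<close>
  have attained: "\<exists>u k. k \<le> T \<and> (u, v) \<in> r ^^ k \<and> x0 u + int k * d \<le> x v" if v: "v < n" for v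
  proof -
    obtain u k where uk: "(u, v) \<in> r ^^ k" "x v = x0 u + int k * d" using walk[of T] v x unfolding walk_def by blast
    show ?thesis
    proof (cases "k \<le> T")
      case False
      have "(u, v) \<in> r\<^sup>*" using uk(1) relpow_imp_rtrancl by blast
      then obtain j where j: "j \<le> card r" "(u, v) \<in> r ^^ j"
        using rtrancl_finite_eq_relpow[OF fin] by auto
      have "int j * d \<le> int k * d" using j(1) T False d by (intro mult_right_mono) auto
      then show ?thesis using j T uk(2) by (intro exI[of _ u] exI[of _ j]) auto
    qed (use uk in auto)
  qed
  \<comment> \<open>A walk witnessing \<open>x u\<close> is extended by the edge and shortened again
    to at most \<open>T\<close> edges, so that \<open>upper\<close> applies.\<close>
  show "x v \<le> x u + d" if "(u, v) \<in> r" for u v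
  proof -
    have "u < n" using that by (simp add: r_def)
    then obtain w k where w: "k \<le> T" "(w, u) \<in> r ^^ k" "x0 w + int k * d \<le> x u"
      using attained by blast
    have "(w, v) \<in> r ^^ Suc k" using w(2) that by auto
    then obtain j where j: "j \<le> T" "j \<le> Suc k" "(w, v) \<in> r ^^ j"
      using relpow_shorten[OF fin T] w(1) by blast
    have "x v \<le> x0 w + int j * d" unfolding x using j upper by blast
    also have "int j * d \<le> int (Suc k) * d" using j(2) d by (intro mult_right_mono) auto
    finally show ?thesis using w(3) by (simp add: algebra_simps)
  qed
  show "y v \<le> x v" if y: "\<forall>v<n. y v \<le> x0 v" "\<forall>(u, v)\<in>r. y v \<le> y u + d" and v: "v < n" for y v
  proof -
    \<comment> \<open>The inequalities for \<open>y\<close> add up along a walk; below they are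
      applied to the walk that realizes \<open>x v\<close>.\<close>
    have "y v \<le> y u + int k * d" if "(u, v) \<in> r ^^ k" for u v k
      using that
    proof (induction k arbitrary: v)
      case (Suc k)
      then obtain w where w: "(u, w) \<in> r ^^ k" "(w, v) \<in> r" by auto
      then have "y v \<le> y w + d" using y(2) by auto
      with Suc.IH[OF w(1)] show ?case by (simp add: algebra_simps)
    qed simp
    moreover obtain u k where uk: "(u, v) \<in> r ^^ k" "x v = x0 u + int k * d"
      using walk[of T] v x unfolding walk_def by blast
    moreover have "u < n"
    proof (cases k)
      case (Suc j)
      then obtain w where "(u, w) \<in> r" using relpow_Suc_D2[of u v j r] uk(1) by blast
      then show ?thesis by (simp add: r_def)
    qed (use uk v in auto)
    ultimately show ?thesis using y(1) by fastforce
  qed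
qed


section \<open>The decision program\<close>

text \<open>A failed check is only recorded in \<open>rBad\<close>; the later phases still run, and
  \<open>final_check\<close> lets the flag override the answer.\<close>

definition fail_if :: "var \<Rightarrow> com" where
  "fail_if x = CIf x (CConst rBad 1) CSkip"

text \<open>The product of row index and \<open>n\<close> is formed by repeated addition, as the
  machine cannot multiply. The loop bound is a counter of an enclosing loop, which is why
  \<open>loops_bounded\<close> admits counters as bounds.\<close>

definition get_adj :: "var \<Rightarrow> var \<Rightarrow> var \<Rightarrow> com" where
  "get_adj z x y =
     CCopy rAddr rAdj ;; CLoop rCnt x (CAdd rAddr rAddr rN) ;; CAdd rAddr rAddr y ;; CLoad z rAddr"

definition relax_pair :: "var \<Rightarrow> var \<Rightarrow> com" where
  "relax_pair xb d =
     get_adj rA rU rV ;;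
     CIf rA
       (CAdd rAddr xb rU ;; CLoad rX rAddr ;; CAdd rX rX d ;;
        CAdd rAddr xb rV ;; CLoad rT rAddr ;; CSub rT rT rX ;;
        CIf rT (CStore rAddr rX) CSkip)
       CSkip"

definition relax_all :: "var \<Rightarrow> var \<Rightarrow> com" where
  "relax_all xb d = CLoop rRound rLim (CLoop rU rN (CLoop rV rN (relax_pair xb d)))"

definition check_pair :: com where
  "check_pair =
     get_adj rA rU rV ;; get_adj rB rV rU ;;
     CSub rT rA rOne ;; fail_if rT ;; CSub rT rZero rA ;; fail_if rT ;;
     CSub rT rA rB ;; fail_if rT ;;
     CSub rT rU rV ;; CIf rT CSkip (CSub rT rV rU ;; CIf rT CSkip (fail_if rA))"

definition check_adj :: com where
  "check_adj = CLoop rU rN (CLoop rV rN check_pair)"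

definition init_vertex :: com where
  "init_vertex =
     CAdd rAddr rDom rV ;; CLoad rA rAddr ;; CAdd rAddr rVal rV ;; CLoad rB rAddr ;;
     CSub rT rA rOne ;; fail_if rT ;; CSub rT rZero rA ;; fail_if rT ;; CSub rX rZero rB ;;
     CAdd rAddr rC rV ;; CStore rAddr rOne ;;
     CIf rA
       (CAdd rAddr rG rV ;; CStore rAddr rB ;; CAdd rAddr rH rV ;; CStore rAddr rX)
       (fail_if rB ;; fail_if rX ;;
        CAdd rAddr rG rV ;; CStore rAddr rBound ;; CAdd rAddr rH rV ;; CStore rAddr rBound)"

definition init_all :: com where
  "init_all = CLoop rV rN init_vertex ;; CStore rC rZero"

definition final_vertex :: com where
  "final_vertex =
     CAdd rAddr rC rV ;; CLoad rA rAddr ;; fail_if rA ;;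
     CAdd rAddr rG rV ;; CLoad rA rAddr ;; CAdd rAddr rH rV ;; CLoad rB rAddr ;;
     CAdd rT rA rB ;; CSub rT rZero rT ;; fail_if rT ;;
     CSub rT rZero rA ;; CIf rT CSkip (CSub rT rZero rB ;; CIf rT CSkip (CConst rFound 1))"

definition final_check :: com where
  "final_check = CLoop rV rN final_vertex ;; CIf rBad (CConst rFound 0) CSkip"

definition decide :: com where
  "decide =
     check_adj ;; init_all ;; relax_all rC rZero ;; relax_all rG rM ;; relax_all rH rM ;;
     final_check"

text \<open>\<open>rX\<close> becomes 64 times the length of an encoding with \<open>n\<close>
  vertices, so that the length test is a mere comparison with \<open>L\<close>.\<close>

definition setup_bases :: "int \<Rightarrow> com" where
  "setup_bases M =
     CConst rOne 1 ;; CConst rZero 0 ;; CConst rM M ;; CConst rBad 0 ;; CConst rFound 0 ;;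
     CConst rSq 0 ;; CLoop rCnt rN (CAdd rSq rSq rN) ;;
     CConst rBound 0 ;; CLoop rCnt rLim (CAdd rBound rBound rM) ;;
     CConst rT 31 ;; CSub rAdj rLim rT ;; CAdd rDom rAdj rSq ;; CAdd rVal rDom rN ;;
     CAdd rC rLim rLim ;; CAdd rG rC rLim ;; CAdd rH rG rLim ;;
     CAdd rX rSq rN ;; CAdd rX rX rN ;; CAdd rX rX rOne ;;
     CAdd rX rX rX ;; CAdd rX rX rX ;; CAdd rX rX rX ;;
     CAdd rX rX rX ;; CAdd rX rX rX ;; CAdd rX rX rX"

definition main_com :: "int \<Rightarrow> com" where
  "main_com M =
     setup_bases M ;;
     CSub rT rX rLim ;; CIf rT CSkip (CSub rT rLim rX ;; CIf rT CSkip decide)"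

text \<open>Heap cell \<open>j\<close> is register \<open>32 + j\<close>, which holds input entry
  \<open>31 + j\<close>; in the block starting at heap address \<open>L - 32\<close> its place is
  \<open>L - 1 + j\<close>. Surplus cells are copied too, all to addresses below
  \<open>2 * L\<close>.\<close>

definition copy_input :: com where
  "copy_input =
     CConst rOne 1 ;;
     CLoop rV rLim
       (CLoad rA rV ;; CAdd rAddr rLim rV ;; CSub rAddr rAddr rOne ;; CStore rAddr rA)"

text \<open>A first entry outside the range from 0 to \<open>L\<close> is replaced by 0. This makes
  \<open>rN\<close> a safe loop bound and causes no wrong acceptance, since \<open>accepts\<close>
  requires a vertex below \<open>n\<close>.\<close>

definition load_size :: com where
  "load_size =
     CConst rT 32 ;; CSub rAddr rLim rT ;; CLoad rN rAddr ;;
     CSub rT rN rLim ;; CIf rT (CConst rN 0) CSkip ;;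
     CConst rT 0 ;; CSub rT rT rN ;; CIf rT (CConst rN 0) CSkip"

lemmas com_defs = fail_if_def get_adj_def relax_pair_def relax_all_def check_pair_def check_adj_def
  init_vertex_def init_all_def final_vertex_def final_check_def decide_def setup_bases_def
  main_com_def copy_input_def load_size_def

lemma loops_bounded_copy_input: "loops_bounded {rLim} copy_input"
  by (simp add: com_defs)

lemma loops_bounded_load_size: "loops_bounded {rLim} load_size"
  by (simp add: com_defs)

lemma loops_bounded_main_com: "loops_bounded {rLim, rN} (main_com M)"
  by (simp add: com_defs)

section \<open>Program loops as folds over arrays\<close>

lemma foldr_upt_rel:
  assumes "\<And>k x s. k < n \<Longrightarrow> Rel x s \<Longrightarrow> Rel (f k x) (F k s)" and "Rel x s"
  shows "Rel (foldr f [0..<n] x) (foldr F [0..<n] s)"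
  using assms
proof (induction n arbitrary: x s)
  case (Suc n)
  then show ?case by (simp add: Suc.IH)
qed simp

lemma sem_fail_if: "sem (fail_if x) s = s(V rBad := if s (V x) > 0 then 1 else s (V rBad))"
  by (auto simp: fail_if_def fun_eq_iff)

lemma foldr_count_add:
  assumes "x \<noteq> i" "y \<noteq> i" "x \<noteq> y"
  shows "foldr (\<lambda>k s. s(V i := int k, V x := s (V x) + s (V y))) [0..<m] s =
    s(V i := (if m = 0 then s (V i) else 0), V x := s (V x) + int m * s (V y))"
  using assms by (induction m arbitrary: s) (auto simp: fun_eq_iff algebra_simps)

lemma sem_count_add:
  assumes "x \<noteq> i" "y \<noteq> i" "x \<noteq> y" and "s (V b) = int m"
  shows "sem (CLoop i b (CAdd x x y)) s = s(V i := 0, V x := s (V x) + int m * s (V y))"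
proof -
  have "(\<lambda>k s. sem (CAdd x x y) (s(V i := int k))) =
      (\<lambda>k s. s(V i := int k, V x := s (V x) + s (V y)))"
    using assms by (auto simp: fun_eq_iff)
  then show ?thesis using assms by (simp add: foldr_count_add fun_eq_iff)
qed

lemma nat_address: "nat (int b + int u * int n + int v) = b + u * n + v"
  by (metis nat_int of_nat_add of_nat_mult)

lemma sem_get_adj:
  assumes "s (V x) = int u" "s (V y) = int v" "s (V rN) = int n" "s (V rAdj) = int b"
    and "x \<notin> {rAddr, rCnt}" "y \<notin> {rAddr, rCnt}"
  shows "sem (get_adj z x y) s =
    s(V rAddr := int b + int u * int n + int v, V rCnt := 0, V z := s (H (b + u * n + v)))"
proof -
  have "sem (CLoop rCnt x (CAdd rAddr rAddr rN)) (s(V rAddr := int b)) =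
      s(V rAddr := int b, V rCnt := 0, V rAddr := int b + int u * int n)"
    using assms by (subst sem_count_add[where m = u]) auto
  then show ?thesis
    using assms by (simp add: get_adj_def nat_address fun_eq_iff del: sem.simps(10))
qed

text \<open>Heap address \<open>L - 32 + i\<close> holds input entry \<open>i\<close>, so the matrix
  begins at \<open>L - 31\<close>, just after \<open>n\<close>. The arrays for connectedness, the
  upper bound and the negated lower bound begin at \<open>2 * L\<close>, \<open>3 * L\<close> and
  \<open>4 * L\<close>, beyond the input.\<close>

definition env :: "int \<Rightarrow> nat \<Rightarrow> nat \<Rightarrow> state \<Rightarrow> bool" where
  "env M L n s \<longleftrightarrow>
     s (V rLim) = int L \<and> s (V rOne) = 1 \<and> s (V rZero) = 0 \<and> s (V rM) = M \<and>
     s (V rBound) = M * int L \<and> s (V rN) = int n \<and>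
     s (V rAdj) = int (L - 31) \<and> s (V rDom) = int (L - 31 + n * n) \<and>
     s (V rVal) = int (L - 31 + n * n + n) \<and>
     s (V rC) = int (2 * L) \<and> s (V rG) = int (3 * L) \<and> s (V rH) = int (4 * L)"

text \<open>Serves as the read-only set in \<open>loops_bounded\<close>: that a phase preserves
  \<open>env\<close> is then a syntactic check.\<close>

definition env_vars :: "var set" where
  "env_vars =
     {rLim, rOne, rZero, rM, rBound, rN, rAdj, rDom, rVal, rC, rG, rH}"

lemma env_cong:
  "env M L n s \<Longrightarrow> (\<And>x. x \<in> env_vars \<Longrightarrow> s' (V x) = s (V x)) \<Longrightarrow> env M L n s'"
  by (simp add: env_def env_vars_def)

lemma env_sem: "loops_bounded K c \<Longrightarrow> env_vars \<subseteq> K \<Longrightarrow> env M L n s \<Longrightarrow> env M L n (sem c s)"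
  by (rule env_cong[of M L n s]) (auto intro!: sem_readonly[of K])

lemma env_upd: "x \<notin> env_vars \<Longrightarrow> env M L n s \<Longrightarrow> env M L n (s(V x := c))"
  by (rule env_cong) auto

lemma sem_relax_pair:
  assumes env: "env M L n s" and uv: "s (V rU) = int u" "s (V rV) = int v"
    and xb: "xb \<in> env_vars" "s (V xb) = int X" and d: "d \<in> env_vars" "s (V d) = dd"
  shows "sem (relax_pair xb d) s (H a) =
    (if s (H (L - 31 + u * n + v)) > 0 \<and> s (H (X + u)) + dd < s (H (X + v)) \<and> a = X + v
     then s (H (X + u)) + dd else s (H a))"
proof -
  define t where "t = sem (get_adj rA rU rV) s"
  have t: "t = s(V rAddr := int (L - 31) + int u * int n + int v, V rCnt := 0,
      V rA := s (H (L - 31 + u * n + v)))"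
    unfolding t_def using env uv by (intro sem_get_adj) (auto simp: env_def)
  have "xb \<notin> {rA, rAddr, rCnt, rX, rT, rU, rV}" "d \<notin> {rA, rAddr, rCnt, rX, rT, rU, rV}"
    using xb(1) d(1) by (auto simp: env_vars_def)
  then have *: "t (V xb) = int X" "t (V d) = dd" "t (V rU) = int u" "t (V rV) = int v"
    "t (V rA) = s (H (L - 31 + u * n + v))" "t (H i) = s (H i)"
    "V xb \<noteq> V rX" "V xb \<noteq> V rAddr" "V d \<noteq> V rX" "V d \<noteq> V rAddr" for i
    using xb(2) d(2) uv unfolding t by auto
  show ?thesis
    unfolding relax_pair_def sem.simps(8) t_def[symmetric]
    using * by (simp add: nat_int_add)
qed

text \<open>The second conjunct is a frame condition; it protects the matrix and the other working
  arrays.\<close>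

definition array :: "nat \<Rightarrow> nat \<Rightarrow> state \<Rightarrow> (nat \<Rightarrow> int) \<Rightarrow> state \<Rightarrow> bool" where
  "array n X s0 x s \<longleftrightarrow>
     (\<forall>v<n. s (H (X + v)) = x v) \<and> (\<forall>a. a \<notin> {X..<X + n} \<longrightarrow> s (H a) = s0 (H a))"

text \<open>Matrix cells lie below every working array, so no relaxation alters them.\<close>

lemma adj_address:
  fixes n L u v :: nat
  assumes "n * n + 2 * n + 1 \<le> L" "u < n" "v < n"
  shows "L - 31 + u * n + v < 2 * L"
proof -
  have "Suc u * n \<le> n * n" using assms(2) by (intro mult_le_mono1) simp
  then show ?thesis using assms by simp
qed

lemma relax_pair_array:
  assumes env: "env M L n s" and uv: "s (V rU) = int u" "s (V rV) = int v" "u < n" "v < n"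
    and xb: "xb \<in> env_vars" "s (V xb) = int X" "2 * L \<le> X" and d: "d \<in> env_vars" "s (V d) = dd"
    and L: "n * n + 2 * n + 1 \<le> L" and arr: "array n X s0 x s"
    and adj: "adj u v \<longleftrightarrow> s0 (H (L - 31 + u * n + v)) > 0"
  shows "array n X s0 (relax adj dd u v x)
    (sem (relax_pair xb d) s)"
proof -
  have "L - 31 + u * n + v < 2 * L" using L uv(3,4) by (rule adj_address)
  then have "s (H (L - 31 + u * n + v)) = s0 (H (L - 31 + u * n + v))"
    using arr xb(3) by (simp add: array_def)
  then show ?thesis
    using arr adj uv(3,4)
    by (auto simp: array_def relax_def sem_relax_pair[OF env uv(1,2) xb(1,2) d])
qed

lemma array_upd_var: "array n X s0 x s \<Longrightarrow> array n X s0 x (s(V y := c))"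
  by (simp add: array_def)

lemma sem_loop:
  "s (V y) = int m \<Longrightarrow> sem (CLoop x y c) s =
     foldr (\<lambda>i s. sem c (s(V x := int i))) [0..<m] (s(V x := int m))"
  by simp

lemma loops_bounded_relax_pair:
  "xb \<in> env_vars \<Longrightarrow> d \<in> env_vars \<Longrightarrow> loops_bounded (insert rV (insert rU env_vars)) (relax_pair xb d)"
  by (simp add: com_defs env_vars_def)

lemma sem_relax_all:
  assumes env: "env M L n s0" and xb: "xb \<in> env_vars" "s0 (V xb) = int X" "2 * L \<le> X"
    and d: "d \<in> env_vars" "s0 (V d) = dd" and L: "n * n + 2 * n + 1 \<le> L"
    and adj: "\<And>u v. u < n \<Longrightarrow> v < n \<Longrightarrow> adj u v \<longleftrightarrow> s0 (H (L - 31 + u * n + v)) > 0"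
    and x: "\<And>v. v < n \<Longrightarrow> s0 (H (X + v)) = x v"
  shows "array n X s0 ((sweep n adj dd ^^ L) x)
    (sem (relax_all xb d) s0)"
proof -
  define rel where "rel y s \<longleftrightarrow> env M L n s \<and> s (V xb) = int X \<and> s (V d) = dd \<and>
    array n X s0 y s" for y s
  have upd: "rel y (s(V z := c))" if "rel y s" "z \<notin> env_vars" for y s z c
    using that xb(1) d(1) by (auto simp: rel_def env_upd array_upd_var)
  have notin [simp]: "rU \<notin> env_vars" "rV \<notin> env_vars" "rRound \<notin> env_vars"
    by (simp_all add: env_vars_def)
  have inner: "rel (relax adj dd u v y) (sem (relax_pair xb d) s) \<and>
      sem (relax_pair xb d) s (V rU) = int u"
    if "rel y s" "s (V rU) = int u" "s (V rV) = int v" "u < n" "v < n" for y s u v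
  proof -
    have ro: "sem (relax_pair xb d) s (V z) = s (V z)" if "z \<in> insert rU env_vars" for z
      using loops_bounded_relax_pair[OF xb(1) d(1)] by (rule sem_readonly) (use that in blast)
    have "env M L n (sem (relax_pair xb d) s)"
      by (rule env_cong[of M L n s]) (use that(1) ro in \<open>auto simp: rel_def\<close>)
    moreover have "array n X s0 (relax adj dd u v y) (sem (relax_pair xb d) s)"
      using that xb(1,3) d(1) L adj by (intro relax_pair_array) (auto simp: rel_def)
    ultimately show ?thesis
      using that(1,2) ro xb(1) d(1) by (simp add: rel_def)
  qed
  have middle: "rel (foldr (\<lambda>v. relax adj dd u v) [0..<n] y)
      (sem (CLoop rV rN (relax_pair xb d)) s)"
    if "rel y s" "s (V rU) = int u" "u < n" for y s u
  proof -
    have n: "s (V rN) = int n" using that(1) by (simp add: rel_def env_def)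
    let ?rel = "\<lambda>y s. rel y s \<and> s (V rU) = int u"
    have "?rel (foldr (\<lambda>v. relax adj dd u v) [0..<n] y)
      (foldr (\<lambda>v s. sem (relax_pair xb d) (s(V rV := int v))) [0..<n] (s(V rV := int n)))"
    proof (rule foldr_upt_rel[where Rel = ?rel])
      show "?rel (relax adj dd u v y) (sem (relax_pair xb d) (s(V rV := int v)))"
        if "v < n" "?rel y s" for v y s
        using that \<open>u < n\<close> by (intro inner) (auto intro: upd)
    qed (use that in \<open>auto intro: upd\<close>)
    then show ?thesis unfolding sem_loop[of s, OF n] by blast
  qed
  have outer: "rel (sweep n adj dd y) (sem (CLoop rU rN (CLoop rV rN (relax_pair xb d))) s)"
    if "rel y s" for y s
  proof -
    have n: "s (V rN) = int n" using that(1) by (simp add: rel_def env_def)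
    have "rel (sweep n adj dd y)
      (foldr (\<lambda>u s. sem (CLoop rV rN (relax_pair xb d)) (s(V rU := int u))) [0..<n]
        (s(V rU := int n)))"
      unfolding sweep_def
    proof (rule foldr_upt_rel[where Rel = rel])
      show "rel (foldr (\<lambda>v. relax adj dd u v) [0..<n] y)
          (sem (CLoop rV rN (relax_pair xb d)) (s(V rU := int u)))"
        if "u < n" "rel y s" for u y s
        using that by (intro middle) (auto intro: upd)
    qed (use that in \<open>auto intro: upd\<close>)
    then show ?thesis unfolding sem_loop[of s, OF n] .
  qed
  have Lim: "s0 (V rLim) = int L" using env by (simp add: env_def)
  have "rel (foldr (\<lambda>_. sweep n adj dd) [0..<L] x)
    (foldr (\<lambda>k s. sem (CLoop rU rN (CLoop rV rN (relax_pair xb d))) (s(V rRound := int k)))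
      [0..<L] (s0(V rRound := int L)))"
  proof (rule foldr_upt_rel[where Rel = rel])
    show "rel (sweep n adj dd y)
        (sem (CLoop rU rN (CLoop rV rN (relax_pair xb d))) (s(V rRound := int k)))"
      if "k < L" "rel y s" for k y s
      using that by (intro outer) (auto intro: upd)
    have "rel x s0" using env xb(2) d(2) x by (simp add: rel_def array_def)
    then show "rel x (s0(V rRound := int L))" by (intro upd) auto
  qed
  moreover have "foldr (\<lambda>_. f) [0..<k] x = (f ^^ k) x" for f :: "(nat \<Rightarrow> int) \<Rightarrow> nat \<Rightarrow> int" and k
    by (induction k arbitrary: x) (simp_all add: funpow_swap1)
  ultimately show ?thesis
    unfolding relax_all_def sem_loop[of s0, OF Lim] by (simp add: rel_def)
qed

section \<open>Input checks and the acceptance criterion\<close>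

lemma all_ge_Suc:
  "k < n \<Longrightarrow> (\<forall>v. k \<le> v \<and> v < n \<longrightarrow> Q v) \<longleftrightarrow> Q k \<and> (\<forall>v. Suc k \<le> v \<and> v < n \<longrightarrow> Q v)"
  for k n :: nat
  by (metis Suc_leI le_eq_less_or_eq less_eq_Suc_le)

lemma ex_ge_Suc:
  "k < n \<Longrightarrow> (\<exists>v. k \<le> v \<and> v < n \<and> Q v) \<longleftrightarrow> Q k \<or> (\<exists>v. Suc k \<le> v \<and> v < n \<and> Q v)"
  for k n :: nat
  by (metis Suc_leI le_eq_less_or_eq less_eq_Suc_le)

text \<open>The one-sided comparison with \<open>a v u\<close> amounts to symmetry once all ordered
  pairs are checked. Inequalities are used because the machine tests only for positivity.\<close>

definition valid_pair :: "(nat \<Rightarrow> nat \<Rightarrow> int) \<Rightarrow> nat \<Rightarrow> nat \<Rightarrow> bool" where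
  "valid_pair a u v \<longleftrightarrow> 0 \<le> a u v \<and> a u v \<le> 1 \<and> a u v \<le> a v u \<and> (u = v \<longrightarrow> a u v \<le> 0)"

text \<open>The last clause enforces the default value 0 that the encoding prescribes outside
  \<open>V'\<close>.\<close>

definition valid_vertex :: "(nat \<Rightarrow> int) \<Rightarrow> (nat \<Rightarrow> int) \<Rightarrow> nat \<Rightarrow> bool" where
  "valid_vertex w f v \<longleftrightarrow> 0 \<le> w v \<and> w v \<le> 1 \<and> (w v \<le> 0 \<longrightarrow> f v = 0)"

abbreviation adj_of :: "(nat \<Rightarrow> nat \<Rightarrow> int) \<Rightarrow> nat \<Rightarrow> nat \<Rightarrow> bool" where
  "adj_of a u v \<equiv> a u v > 0"

text \<open>Reachability from vertex 0: the value 0 stands for reached, and step 0 passes it on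
  along edges.\<close>

definition reach_bound :: "nat \<Rightarrow> nat \<Rightarrow> (nat \<Rightarrow> nat \<Rightarrow> int) \<Rightarrow> nat \<Rightarrow> int" where
  "reach_bound L n a = (sweep n (adj_of a) 0 ^^ L) (\<lambda>v. if v = 0 then 0 else 1)"

definition upper_bound :: "int \<Rightarrow> nat \<Rightarrow> nat \<Rightarrow> (nat \<Rightarrow> nat \<Rightarrow> int) \<Rightarrow> (nat \<Rightarrow> int) \<Rightarrow>
    (nat \<Rightarrow> int) \<Rightarrow> nat \<Rightarrow> int" where
  "upper_bound M L n a w f =
     (sweep n (adj_of a) M ^^ L) (\<lambda>v. if w v > 0 then f v else M * int L)"

text \<open>The negated lower bound is the upper bound for the negated prescribed values.\<close>

definition accepts :: "int \<Rightarrow> nat \<Rightarrow> nat \<Rightarrow> (nat \<Rightarrow> nat \<Rightarrow> int) \<Rightarrow> (nat \<Rightarrow> int) \<Rightarrow> (nat \<Rightarrow> int) \<Rightarrow> bool"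
  where
  "accepts M L n a w f \<longleftrightarrow>
     (\<forall>u<n. \<forall>v<n. valid_pair a u v) \<and> (\<forall>v<n. valid_vertex w f v) \<and>
     (\<forall>v<n. reach_bound L n a v \<le> 0 \<and>
       0 \<le> upper_bound M L n a w f v + upper_bound M L n a w (\<lambda>v. - f v) v) \<and>
     (\<exists>v<n. 0 \<le> upper_bound M L n a w f v \<and> 0 \<le> upper_bound M L n a w (\<lambda>v. - f v) v)"

lemma sem_check_pair:
  assumes env: "env M L n s" and uv: "s (V rU) = int u" "s (V rV) = int v"
    and a: "s (H (L - 31 + u * n + v)) = a u v" "s (H (L - 31 + v * n + u)) = a v u"
  shows "sem check_pair s (H i) = s (H i)" "sem check_pair s (V rFound) = s (V rFound)"
    "sem check_pair s (V rBad) = (if valid_pair a u v then s (V rBad) else 1)"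
proof -
  define t1 where "t1 = sem (get_adj rA rU rV) s"
  have t1: "t1 = s(V rAddr := int (L - 31) + int u * int n + int v, V rCnt := 0,
      V rA := s (H (L - 31 + u * n + v)))"
    unfolding t1_def using env uv by (intro sem_get_adj) (auto simp: env_def)
  define t2 where "t2 = sem (get_adj rB rV rU) t1"
  have t2: "t2 = t1(V rAddr := int (L - 31) + int v * int n + int u, V rCnt := 0,
      V rB := t1 (H (L - 31 + v * n + u)))"
    unfolding t2_def using env uv by (intro sem_get_adj) (auto simp: env_def t1)
  have *: "t2 (V rA) = a u v" "t2 (V rB) = a v u" "t2 (V rU) = int u" "t2 (V rV) = int v"
    "t2 (V rOne) = 1" "t2 (V rZero) = 0" "t2 (V rBad) = s (V rBad)"
    "t2 (V rFound) = s (V rFound)" "t2 (H i) = s (H i)" for i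
    using env uv unfolding t2 unfolding t1 by (simp_all add: env_def a)
  show "sem check_pair s (H i) = s (H i)" "sem check_pair s (V rFound) = s (V rFound)"
    "sem check_pair s (V rBad) = (if valid_pair a u v then s (V rBad) else 1)"
    unfolding check_pair_def sem.simps(8) t1_def[symmetric] t2_def[symmetric]
    using * by (auto simp: sem_fail_if valid_pair_def)
qed

text \<open>A raised flag stays raised, so consecutive checks combine by conjoining their conditions
  in \<open>Q\<close>.\<close>

definition checked :: "int \<Rightarrow> nat \<Rightarrow> nat \<Rightarrow> state \<Rightarrow> bool \<Rightarrow> state \<Rightarrow> bool" where
  "checked M L n s0 Q s \<longleftrightarrow> env M L n s \<and> (\<forall>i. s (H i) = s0 (H i)) \<and>
     s (V rFound) = s0 (V rFound) \<and> s (V rBad) = (if Q then s0 (V rBad) else 1)"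

lemma checked_upd:
  "checked M L n s0 Q s \<Longrightarrow> x \<notin> env_vars \<Longrightarrow> x \<notin> {rFound, rBad} \<Longrightarrow>
   checked M L n s0 Q (s(V x := c))"
  by (auto simp: checked_def env_upd)

lemma loops_bounded_check_pair: "loops_bounded (insert rV (insert rU env_vars)) check_pair"
  by (simp add: com_defs env_vars_def)

lemma not_env_vars [simp]:
  "rU \<notin> env_vars" "rV \<notin> env_vars" "rBad \<notin> env_vars" "rFound \<notin> env_vars"
  by (simp_all add: env_vars_def)

lemma sem_check_adj:
  assumes env: "env M L n s0"
    and a: "\<And>u v. u < n \<Longrightarrow> v < n \<Longrightarrow> s0 (H (L - 31 + u * n + v)) = a u v"
  shows "checked M L n s0 (\<forall>u<n. \<forall>v<n. valid_pair a u v) (sem check_adj s0)"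
proof -
  have n: "s (V rN) = int n" if "env M L n s" for s
    using that by (simp add: env_def)
  have inner: "checked M L n s0 (Q \<and> valid_pair a u v) (sem check_pair s) \<and>
      sem check_pair s (V rU) = int u"
    if "checked M L n s0 Q s" "s (V rU) = int u" "s (V rV) = int v" "u < n" "v < n" for Q s u v
  proof -
    have e: "env M L n s" using that(1) by (simp add: checked_def)
    have "s (H (L - 31 + u * n + v)) = a u v" "s (H (L - 31 + v * n + u)) = a v u"
      using that a by (simp_all add: checked_def)
    note spec = sem_check_pair[OF e that(2,3) this]
    have "env M L n (sem check_pair s)"
      by (rule env_sem[OF loops_bounded_check_pair _ e]) auto
    moreover have "sem check_pair s (V rU) = s (V rU)"
      using loops_bounded_check_pair by (rule sem_readonly) auto
    ultimately show ?thesis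
      using that(1,2) by (auto simp: checked_def spec)
  qed
  have middle: "checked M L n s0 (Q \<and> (\<forall>v<n. valid_pair a u v)) (sem (CLoop rV rN check_pair) s)"
    if s: "checked M L n s0 Q s" "s (V rU) = int u" and u: "u < n" for Q s u
  proof -
    let ?I = "\<lambda>k t. checked M L n s0 (Q \<and> (\<forall>v. k \<le> v \<and> v < n \<longrightarrow> valid_pair a u v)) t \<and>
      t (V rU) = int u"
    have "?I 0 (foldr (\<lambda>k s. sem check_pair (s(V rV := int k))) [0..<n] (s(V rV := int n)))"
    proof (rule foldr_upt_invariant[where I = ?I])
      fix k t
      assume k: "k < n" and t: "?I (Suc k) t"
      let ?Q = "Q \<and> (\<forall>v. Suc k \<le> v \<and> v < n \<longrightarrow> valid_pair a u v)"
      have "checked M L n s0 (?Q \<and> valid_pair a u k) (sem check_pair (t(V rV := int k))) \<and>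
          sem check_pair (t(V rV := int k)) (V rU) = int u"
        using t k u by (intro inner) (auto intro!: checked_upd)
      moreover have "?Q \<and> valid_pair a u k \<longleftrightarrow>
          Q \<and> (\<forall>v. k \<le> v \<and> v < n \<longrightarrow> valid_pair a u v)"
        using all_ge_Suc[OF k, of "valid_pair a u"] by blast
      ultimately show "?I k (sem check_pair (t(V rV := int k)))" by simp
    next
      have "Q \<and> (\<forall>v. n \<le> v \<and> v < n \<longrightarrow> valid_pair a u v) \<longleftrightarrow> Q" by auto
      then show "?I n (s(V rV := int n))"
        using s by (simp add: checked_upd)
    qed
    then show ?thesis
      using s(1) by (subst sem_loop[where m = n]) (auto simp: n checked_def)
  qed
  let ?I = "\<lambda>k. checked M L n s0 (\<forall>u. k \<le> u \<and> u < n \<longrightarrow> (\<forall>v<n. valid_pair a u v))"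
  have "?I 0 (foldr (\<lambda>k s. sem (CLoop rV rN check_pair) (s(V rU := int k))) [0..<n]
      (s0(V rU := int n)))"
  proof (rule foldr_upt_invariant[where I = ?I])
    fix k t
    assume k: "k < n" and t: "?I (Suc k) t"
    let ?Q = "\<forall>u. Suc k \<le> u \<and> u < n \<longrightarrow> (\<forall>v<n. valid_pair a u v)"
    have "checked M L n s0 (?Q \<and> (\<forall>v<n. valid_pair a k v))
        (sem (CLoop rV rN check_pair) (t(V rU := int k)))"
      using t k by (intro middle) (auto intro!: checked_upd)
    moreover have "?Q \<and> (\<forall>v<n. valid_pair a k v) \<longleftrightarrow>
        (\<forall>u. k \<le> u \<and> u < n \<longrightarrow> (\<forall>v<n. valid_pair a u v))"
      using all_ge_Suc[OF k, of "\<lambda>u. \<forall>v<n. valid_pair a u v"] by blast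
    ultimately show "?I k (sem (CLoop rV rN check_pair) (t(V rU := int k)))" by simp
  next
    have "checked M L n s0 True s0" using env by (simp add: checked_def)
    then have "checked M L n s0 True (s0(V rU := int n))" by (rule checked_upd) auto
    moreover have "(\<forall>u. n \<le> u \<and> u < n \<longrightarrow> (\<forall>v<n. valid_pair a u v)) \<longleftrightarrow> True" by auto
    ultimately show "?I n (s0(V rU := int n))" by simp
  qed
  then show ?thesis
    unfolding check_adj_def sem_loop[of s0, OF n[OF env]] by simp
qed

lemma sem_init_vertex:
  assumes env: "env M L n s" and v: "s (V rV) = int v" "v < L"
    and wf: "s (H (L - 31 + n * n + v)) = w v" "s (H (L - 31 + n * n + n + v)) = f v"
    and L: "L - 31 + n * n + n + v < 2 * L"
  shows "sem init_vertex s (H i) =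
      (if i = 2 * L + v then 1
       else if i = 3 * L + v then if w v > 0 then f v else M * int L
       else if i = 4 * L + v then if w v > 0 then - f v else M * int L
       else s (H i))"
    "sem init_vertex s (V rFound) = s (V rFound)"
    "sem init_vertex s (V rBad) = (if valid_vertex w f v then s (V rBad) else 1)"
proof -
  have addr: "nat (2 * int L + int v) = 2 * L + v" "nat (3 * int L + int v) = 3 * L + v"
    "nat (4 * int L + int v) = 4 * L + v"
    "nat (int (L - 31) + int n * int n + int v) = L - 31 + n * n + v"
    "nat (int (L - 31) + int n * int n + int n + int v) = L - 31 + n * n + n + v"
    by (simp_all add: nat_eq_iff)
  show "sem init_vertex s (H i) =
      (if i = 2 * L + v then 1
       else if i = 3 * L + v then if w v > 0 then f v else M * int L
       else if i = 4 * L + v then if w v > 0 then - f v else M * int L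
       else s (H i))"
    "sem init_vertex s (V rFound) = s (V rFound)"
    "sem init_vertex s (V rBad) = (if valid_vertex w f v then s (V rBad) else 1)"
    using assms
    by (auto simp: init_vertex_def sem_fail_if env_def addr valid_vertex_def)
qed

lemma loops_bounded_init_vertex: "loops_bounded (insert rV env_vars) init_vertex"
  by (simp add: com_defs env_vars_def)

lemma loops_bounded_final_vertex: "loops_bounded (insert rV env_vars) final_vertex"
  by (simp add: com_defs env_vars_def)

lemma sem_init_all:
  assumes env: "env M L n s0" and L: "n * n + 2 * n + 1 \<le> L" "64 \<le> L"
    and w: "\<And>v. v < n \<Longrightarrow> s0 (H (L - 31 + n * n + v)) = w v"
    and f: "\<And>v. v < n \<Longrightarrow> s0 (H (L - 31 + n * n + n + v)) = f v"
  shows "env M L n (sem init_all s0)" "i < 2 * L \<Longrightarrow> sem init_all s0 (H i) = s0 (H i)"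
    "sem init_all s0 (V rFound) = s0 (V rFound)"
    "sem init_all s0 (V rBad) = (if \<forall>v<n. valid_vertex w f v then s0 (V rBad) else 1)"
    "v < n \<Longrightarrow> sem init_all s0 (H (2 * L + v)) = (if v = 0 then 0 else 1)"
    "v < n \<Longrightarrow> sem init_all s0 (H (3 * L + v)) = (if w v > 0 then f v else M * int L)"
    "v < n \<Longrightarrow> sem init_all s0 (H (4 * L + v)) = (if w v > 0 then - f v else M * int L)"
proof -
  let ?I = "\<lambda>k t. env M L n t \<and> (\<forall>i<2 * L. t (H i) = s0 (H i)) \<and>
    t (V rFound) = s0 (V rFound) \<and>
    t (V rBad) = (if \<forall>v. k \<le> v \<and> v < n \<longrightarrow> valid_vertex w f v then s0 (V rBad) else 1) \<and>
    (\<forall>v. k \<le> v \<and> v < n \<longrightarrow> t (H (2 * L + v)) = 1 \<and>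
      t (H (3 * L + v)) = (if w v > 0 then f v else M * int L) \<and>
      t (H (4 * L + v)) = (if w v > 0 then - f v else M * int L))"
  have n: "s0 (V rN) = int n" using env by (simp add: env_def)
  have "?I 0 (foldr (\<lambda>k s. sem init_vertex (s(V rV := int k))) [0..<n] (s0(V rV := int n)))"
  proof (rule foldr_upt_invariant[where I = ?I])
    fix k t
    assume k: "k < n" and t: "?I (Suc k) t"
    let ?t = "t(V rV := int k)"
    have e: "env M L n ?t" using t by (simp add: env_upd)
    have bound: "L - 31 + n * n + n + k < 2 * L" "L - 31 + n * n + k < 2 * L" "k < L"
      using k L by linarith+
    have "?t (H (L - 31 + n * n + k)) = w k" "?t (H (L - 31 + n * n + n + k)) = f k"
      using t bound w[OF k] f[OF k] by simp_all
    note spec = sem_init_vertex[where w = w and f = f, OF e _ bound(3) this bound(1)]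
    have "env M L n (sem init_vertex ?t)"
      by (rule env_sem[OF loops_bounded_init_vertex _ e]) auto
    moreover have "\<forall>i<2 * L. sem init_vertex ?t (H i) = s0 (H i)"
      using t by (simp add: spec)
    moreover have "sem init_vertex ?t (V rFound) = s0 (V rFound)"
      using t by (simp add: spec)
    moreover have "sem init_vertex ?t (V rBad) =
        (if \<forall>v. k \<le> v \<and> v < n \<longrightarrow> valid_vertex w f v then s0 (V rBad) else 1)"
      using t all_ge_Suc[OF k, of "valid_vertex w f"] by (auto simp: spec)
    moreover have "\<forall>v. k \<le> v \<and> v < n \<longrightarrow> sem init_vertex ?t (H (2 * L + v)) = 1 \<and>
      sem init_vertex ?t (H (3 * L + v)) = (if w v > 0 then f v else M * int L) \<and>
      sem init_vertex ?t (H (4 * L + v)) = (if w v > 0 then - f v else M * int L)"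
    proof (intro allI impI)
      fix v assume v: "k \<le> v \<and> v < n"
      have "k < L" "v < L" using k v L(1) by linarith+
      show "sem init_vertex ?t (H (2 * L + v)) = 1 \<and>
        sem init_vertex ?t (H (3 * L + v)) = (if w v > 0 then f v else M * int L) \<and>
        sem init_vertex ?t (H (4 * L + v)) = (if w v > 0 then - f v else M * int L)"
      proof (cases "v = k")
        case True
        then show ?thesis using \<open>k < L\<close> by (simp add: spec)
      next
        case False
        then have "Suc k \<le> v" using v by simp
        then show ?thesis using t v False \<open>k < L\<close> \<open>v < L\<close> by (simp add: spec)
      qed
    qed
    ultimately show "?I k (sem init_vertex ?t)" by blast
  next
    show "?I n (s0(V rV := int n))" using env by (auto simp: env_upd)
  qed
  then have I: "?I 0 (sem (CLoop rV rN init_vertex) s0)"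
    unfolding sem_loop[of s0, OF n] .
  define t where "t = sem (CLoop rV rN init_vertex) s0"
  have t: "?I 0 t" using I unfolding t_def .
  \<comment> \<open>The loop marks every vertex as unreached; the closing store resets vertex 0, the
    start of the search.\<close>
  have eq: "sem init_all s0 = t(H (2 * L) := 0)"
    using t by (simp add: init_all_def t_def[symmetric] env_def nat_mult_distrib del: sem.simps(10))
  show "env M L n (sem init_all s0)"
    unfolding eq by (rule env_cong[of M L n t]) (use t in auto)
  show "sem init_all s0 (H i) = s0 (H i)" if "i < 2 * L"
    unfolding eq using t that by simp
  show "sem init_all s0 (V rFound) = s0 (V rFound)"
    unfolding eq using t by simp
  show "sem init_all s0 (V rBad) = (if \<forall>v<n. valid_vertex w f v then s0 (V rBad) else 1)"
    unfolding eq using t by simp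
  have "n \<le> L" "0 < L" using L by linarith+
  then show "sem init_all s0 (H (2 * L + v)) = (if v = 0 then 0 else 1)"
    "sem init_all s0 (H (3 * L + v)) = (if w v > 0 then f v else M * int L)"
    "sem init_all s0 (H (4 * L + v)) = (if w v > 0 then - f v else M * int L)" if "v < n"
    unfolding eq using t that by auto
qed

lemma sem_final_vertex:
  assumes env: "env M L n s" and v: "s (V rV) = int v"
    and x: "s (H (2 * L + v)) = c v" "s (H (3 * L + v)) = g v" "s (H (4 * L + v)) = h v"
  shows "sem final_vertex s (H i) = s (H i)"
    "sem final_vertex s (V rFound) = (if 0 \<le> g v \<and> 0 \<le> h v then 1 else s (V rFound))"
    "sem final_vertex s (V rBad) = (if c v \<le> 0 \<and> 0 \<le> g v + h v then s (V rBad) else 1)"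
proof -
  have addr: "nat (2 * int L + int v) = 2 * L + v" "nat (3 * int L + int v) = 3 * L + v"
    "nat (4 * int L + int v) = 4 * L + v"
    by (simp_all add: nat_eq_iff)
  show "sem final_vertex s (H i) = s (H i)"
    "sem final_vertex s (V rFound) = (if 0 \<le> g v \<and> 0 \<le> h v then 1 else s (V rFound))"
    "sem final_vertex s (V rBad) = (if c v \<le> 0 \<and> 0 \<le> g v + h v then s (V rBad) else 1)"
    using assms by (auto simp: final_vertex_def sem_fail_if env_def addr)
qed

lemma sem_final_check:
  assumes env: "env M L n s0" and bad: "s0 (V rBad) = (if Q then 0 else 1)" "s0 (V rFound) = 0"
    and x: "\<And>v. v < n \<Longrightarrow> s0 (H (2 * L + v)) = c v" "\<And>v. v < n \<Longrightarrow> s0 (H (3 * L + v)) = g v"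
      "\<And>v. v < n \<Longrightarrow> s0 (H (4 * L + v)) = h v"
  shows "sem final_check s0 (V rFound) =
    (if Q \<and> (\<forall>v<n. c v \<le> 0 \<and> 0 \<le> g v + h v) \<and> (\<exists>v<n. 0 \<le> g v \<and> 0 \<le> h v) then 1 else 0)"
proof -
  let ?P = "\<lambda>v. c v \<le> 0 \<and> 0 \<le> g v + h v" and ?R = "\<lambda>v. 0 \<le> g v \<and> 0 \<le> h v"
  let ?I = "\<lambda>k t. env M L n t \<and> (\<forall>i. t (H i) = s0 (H i)) \<and>
    t (V rFound) = (if \<exists>v. k \<le> v \<and> v < n \<and> ?R v then 1 else 0) \<and>
    t (V rBad) = (if \<forall>v. k \<le> v \<and> v < n \<longrightarrow> ?P v then s0 (V rBad) else 1)"
  have n: "s0 (V rN) = int n" using env by (simp add: env_def)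
  have "?I 0 (foldr (\<lambda>k s. sem final_vertex (s(V rV := int k))) [0..<n] (s0(V rV := int n)))"
  proof (rule foldr_upt_invariant[where I = ?I])
    fix k t
    assume k: "k < n" and t: "?I (Suc k) t"
    let ?t = "t(V rV := int k)"
    have e: "env M L n ?t" using t by (simp add: env_upd)
    have "?t (H (2 * L + k)) = c k" "?t (H (3 * L + k)) = g k" "?t (H (4 * L + k)) = h k"
      using t x k by simp_all
    note spec = sem_final_vertex[where c = c and g = g and h = h, OF e _ this]
    have "env M L n (sem final_vertex ?t)"
      by (rule env_sem[OF loops_bounded_final_vertex _ e]) auto
    moreover have "\<forall>i. sem final_vertex ?t (H i) = s0 (H i)"
      using t by (simp add: spec)
    moreover have "sem final_vertex ?t (V rFound) = (if \<exists>v. k \<le> v \<and> v < n \<and> ?R v then 1 else 0)"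
      using t ex_ge_Suc[OF k, of ?R] by (auto simp: spec)
    moreover have "sem final_vertex ?t (V rBad) =
        (if \<forall>v. k \<le> v \<and> v < n \<longrightarrow> ?P v then s0 (V rBad) else 1)"
      using t all_ge_Suc[OF k, of ?P] by (auto simp: spec)
    ultimately show "?I k (sem final_vertex ?t)" by blast
  next
    show "?I n (s0(V rV := int n))" using env bad(2) by (auto simp: env_upd)
  qed
  then have "?I 0 (sem (CLoop rV rN final_vertex) s0)"
    unfolding sem_loop[of s0, OF n] .
  then show ?thesis
    using bad(1) by (auto simp: final_check_def simp del: sem.simps(10))
qed

lemma loops_bounded_relax_all:
  "xb \<in> env_vars \<Longrightarrow> d \<in> env_vars \<Longrightarrow> loops_bounded (insert rBad (insert rFound env_vars)) (relax_all xb d)"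
  by (simp add: com_defs env_vars_def)

lemma sem_decide:
  assumes env: "env M L n s" and L: "n * n + 2 * n + 1 \<le> L" "64 \<le> L"
    and flags: "s (V rBad) = 0" "s (V rFound) = 0"
    and a: "\<And>u v. u < n \<Longrightarrow> v < n \<Longrightarrow> s (H (L - 31 + u * n + v)) = a u v"
    and w: "\<And>v. v < n \<Longrightarrow> s (H (L - 31 + n * n + v)) = w v"
    and f: "\<And>v. v < n \<Longrightarrow> s (H (L - 31 + n * n + n + v)) = f v"
  shows "sem decide s (V rFound) = (if accepts M L n a w f then 1 else 0)"
proof -
  let ?Q1 = "\<forall>u<n. \<forall>v<n. valid_pair a u v" and ?Q2 = "\<forall>v<n. valid_vertex w f v"
  define s1 where "s1 = sem check_adj s"
  define s2 where "s2 = sem init_all s1"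
  define s3 where "s3 = sem (relax_all rC rZero) s2"
  define s4 where "s4 = sem (relax_all rG rM) s3"
  define s5 where "s5 = sem (relax_all rH rM) s4"
  have "checked M L n s ?Q1 s1" unfolding s1_def by (rule sem_check_adj[OF env a])
  then have s1: "env M L n s1" "s1 (H i) = s (H i)" "s1 (V rFound) = 0"
    "s1 (V rBad) = (if ?Q1 then 0 else 1)" for i
    using flags by (auto simp: checked_def)
  have nL: "n \<le> L" using L(1) by linarith
  have s2: "env M L n s2" "\<And>i. i < 2 * L \<Longrightarrow> s2 (H i) = s (H i)" "s2 (V rFound) = 0"
    "s2 (V rBad) = (if ?Q1 \<and> ?Q2 then 0 else 1)"
    "\<And>v. v < n \<Longrightarrow> s2 (H (2 * L + v)) = (if v = 0 then 0 else 1)"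
    "\<And>v. v < n \<Longrightarrow> s2 (H (3 * L + v)) = (if w v > 0 then f v else M * int L)"
    "\<And>v. v < n \<Longrightarrow> s2 (H (4 * L + v)) = (if w v > 0 then - f v else M * int L)"
    unfolding s2_def
    using sem_init_all[where w = w and f = f, OF s1(1) L] s1(2-4) w f by simp_all
  \<comment> \<open>No phase writes below \<open>2 * L\<close>, so each of the three relaxations
    reads the original matrix.\<close>
  have adj: "adj_of a u v \<longleftrightarrow> t (H (L - 31 + u * n + v)) > 0"
    if "\<And>i. i < 2 * L \<Longrightarrow> t (H i) = s (H i)" "u < n" "v < n" for t u v
    using that(1)[OF adj_address[OF L(1) that(2,3)]] a[OF that(2,3)] by simp
  have relax: "env M L n (sem (relax_all xb d) t)" "sem (relax_all xb d) t (V rFound) = t (V rFound)"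
      "sem (relax_all xb d) t (V rBad) = t (V rBad)"
    if "env M L n t" "xb \<in> env_vars" "d \<in> env_vars" for t xb d
    using that(1) loops_bounded_relax_all[OF that(2,3)] by (auto intro: env_sem sem_readonly)
  have vars: "rC \<in> env_vars" "rG \<in> env_vars" "rH \<in> env_vars" "rZero \<in> env_vars" "rM \<in> env_vars"
    by (simp_all add: env_vars_def)
  have regs: "t (V rC) = int (2 * L)" "t (V rG) = int (3 * L)" "t (V rH) = int (4 * L)"
    "t (V rZero) = 0" "t (V rM) = M" if "env M L n t" for t
    using that by (simp_all add: env_def)
  have "array n (2 * L) s2 (reach_bound L n a) s3"
    unfolding s3_def reach_bound_def using s2(1,5) adj[of s2, OF s2(2)] vars regs
    by (intro sem_relax_all[OF s2(1) _ _ _ _ _ L(1)]) auto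
  then have s3: "\<And>v. v < n \<Longrightarrow> s3 (H (2 * L + v)) = reach_bound L n a v"
    "\<And>i. i < 2 * L \<Longrightarrow> s3 (H i) = s (H i)" "\<And>i. i \<ge> 3 * L \<Longrightarrow> s3 (H i) = s2 (H i)"
    using s2(2) nL by (auto simp: array_def)
  have e3: "env M L n s3" "s3 (V rFound) = 0" "s3 (V rBad) = s2 (V rBad)"
    unfolding s3_def using relax[OF s2(1)] vars s2(3) by auto
  have "array n (3 * L) s3 (upper_bound M L n a w f) s4"
    unfolding s4_def upper_bound_def using e3(1) s3(3) s2(6) adj[of s3, OF s3(2)] vars regs
    by (intro sem_relax_all[OF e3(1) _ _ _ _ _ L(1)]) auto
  then have s4: "\<And>v. v < n \<Longrightarrow> s4 (H (3 * L + v)) = upper_bound M L n a w f v"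
    "\<And>i. i < 3 * L \<Longrightarrow> s4 (H i) = s3 (H i)" "\<And>i. i \<ge> 4 * L \<Longrightarrow> s4 (H i) = s3 (H i)"
    using nL by (auto simp: array_def)
  have s4': "\<And>i. i < 2 * L \<Longrightarrow> s4 (H i) = s (H i)" using s4(2) s3(2) by simp
  have e4: "env M L n s4" "s4 (V rFound) = 0" "s4 (V rBad) = s2 (V rBad)"
    unfolding s4_def using relax[OF e3(1)] vars e3 by auto
  have "array n (4 * L) s4 (upper_bound M L n a w (\<lambda>v. - f v)) s5"
    unfolding s5_def upper_bound_def
    using e4(1) s4(3) s3(3) s2(7) adj[of s4, OF s4'] vars regs
    by (intro sem_relax_all[OF e4(1) _ _ _ _ _ L(1)]) auto
  then have s5: "\<And>v. v < n \<Longrightarrow> s5 (H (4 * L + v)) = upper_bound M L n a w (\<lambda>v. - f v) v"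
    "\<And>i. i < 4 * L \<Longrightarrow> s5 (H i) = s4 (H i)"
    by (auto simp: array_def)
  have e5: "env M L n s5" "s5 (V rFound) = 0" "s5 (V rBad) = (if ?Q1 \<and> ?Q2 then 0 else 1)"
    unfolding s5_def using relax[OF e4(1)] vars e4 s2(4) by auto
  have "s5 (H (2 * L + v)) = reach_bound L n a v" "s5 (H (3 * L + v)) = upper_bound M L n a w f v"
    if "v < n" for v
    using that nL s5(2) s4(1,2) s3(1) by simp_all
  note final = sem_final_check[OF e5(1,3,2) this s5(1)]
  have "sem decide s = sem final_check s5"
    by (simp add: decide_def s1_def s2_def s3_def s4_def s5_def)
  then show ?thesis unfolding final accepts_def by (simp add: final conj_assoc)
qed


section \<open>From the input to the main program\<close>

lemma sem_setup_bases:
  assumes s: "s (V rLim) = int L" "s (V rN) = int n" and L: "64 \<le> L"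
  shows "env M L n (sem (setup_bases M) s)" "sem (setup_bases M) s (V rBad) = 0"
    "sem (setup_bases M) s (V rFound) = 0" "sem (setup_bases M) s (H i) = s (H i)"
    "sem (setup_bases M) s (V rX) = int (64 * (n * n + 2 * n + 1))"
  using s L
  by (auto simp: setup_bases_def sem_count_add[where m = n and b = rN]
      sem_count_add[where m = L and b = rLim] env_def of_nat_diff algebra_simps
      simp del: sem.simps(10))

text \<open>The cells are assumed to hold \<open>x\<close> only under the length test: for other
  inputs an encoding with \<open>n\<close> vertices may extend beyond the input.\<close>

lemma sem_main_com:
  assumes s: "s (V rLim) = int L" "s (V rN) = int n" and L: "64 \<le> L"
    and cells: "\<And>i. i < n * n + 2 * n + 1 \<Longrightarrow> 64 * (n * n + 2 * n + 1) = L \<Longrightarrow> s (H (L - 32 + i)) = x i"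
  shows "sem (main_com M) s (V rFound) =
    (if 64 * (n * n + 2 * n + 1) = L \<and>
        accepts M L n (\<lambda>u v. x (1 + u * n + v)) (\<lambda>v. x (1 + n * n + v)) (\<lambda>v. x (1 + n * n + n + v))
     then 1 else 0)"
proof -
  define t where "t = sem (setup_bases M) s"
  note t = sem_setup_bases[where M = M, OF s L, folded t_def]
  have lim: "t (V rLim) = int L" using t(1) by (simp add: env_def)
  define q where "q = 64 * (n * n + 2 * n + 1)"
  have "t (V rX) = int q" unfolding q_def by (rule t(5))
  \<comment> \<open>\<open>decide\<close> runs only if both differences are nonpositive, hence zero;
    this leaves 0 in \<open>rT\<close>.\<close>
  then have unfold: "sem (main_com M) s (V rFound) =
    (if q = L then sem decide (t(V rT := 0)) (V rFound) else 0)"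
    unfolding main_com_def sem.simps(8) t_def[symmetric]
    using lim t(3) by (cases q L rule: linorder_cases) auto
  show ?thesis
  proof (cases "64 * (n * n + 2 * n + 1) = L")
    case True
    let ?t = "t(V rT := 0)"
    have cell: "?t (H (L - 31 + i)) = x (1 + i)" if "i < n * n + 2 * n" for i
    proof -
      have eq: "L - 31 + i = L - 32 + (1 + i)" using L by simp
      have "s (H (L - 32 + (1 + i))) = x (1 + i)"
        by (rule cells[OF _ True]) (use that in simp)
      then show ?thesis unfolding eq using t(4) by simp
    qed
    have "sem decide ?t (V rFound) =
      (if accepts M L n (\<lambda>u v. x (1 + u * n + v)) (\<lambda>v. x (1 + n * n + v)) (\<lambda>v. x (1 + n * n + n + v))
       then 1 else 0)"
    proof (rule sem_decide)
      show "env M L n ?t" using t(1) by (intro env_upd) (simp_all add: env_vars_def)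
      have "x \<le> 64 * x" for x :: nat by simp
      from this[of "n * n + 2 * n + 1"] show "n * n + 2 * n + 1 \<le> L" unfolding True .
      show "?t (H (L - 31 + u * n + v)) = x (1 + u * n + v)" if "u < n" "v < n" for u v
      proof -
        have "Suc u * n \<le> n * n" using that(1) by (intro mult_le_mono1) simp
        then have "u * n + v < n * n + 2 * n" using that(2) by simp
        from cell[OF this] show ?thesis by (simp add: add.assoc)
      qed
      show "?t (H (L - 31 + n * n + v)) = x (1 + n * n + v)" if "v < n" for v
        using cell[of "n * n + v"] that by (simp add: add.assoc)
      show "?t (H (L - 31 + n * n + n + v)) = x (1 + n * n + n + v)" if "v < n" for v
        using cell[of "n * n + n + v"] that by (simp add: add.assoc)
    qed (use L t in simp_all)
    then show ?thesis unfolding unfold q_def using True by simp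
  qed (simp add: unfold q_def)
qed

lemma sem_load_size:
  assumes "s (V rLim) = int L" "64 \<le> L" "s (H (L - 32)) = x"
  shows "sem load_size s (V rN) = int (if 0 \<le> x \<and> x \<le> int L then nat x else 0)"
    "sem load_size s (H i) = s (H i)" "sem load_size s (V rLim) = int L"
proof -
  have "nat (int L - 32) = L - 32" using assms(2) by simp
  then show "sem load_size s (V rN) = int (if 0 \<le> x \<and> x \<le> int L then nat x else 0)"
    "sem load_size s (H i) = s (H i)" "sem load_size s (V rLim) = int L"
    using assms by (auto simp: load_size_def)
qed

lemma sem_copy_input:
  assumes s: "s (V rLim) = int L" and L: "64 \<le> L"
    and x: "\<And>j. 32 + j < L \<Longrightarrow> s (H j) = x (31 + j)" "\<And>i. i < 31 \<Longrightarrow> s (H (L - 32 + i)) = x i"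
  shows "i < L - 1 \<Longrightarrow> sem copy_input s (H (L - 32 + i)) = x i"
    "sem copy_input s (V rLim) = int L"
proof -
  let ?body = "CLoad rA rV ;; CAdd rAddr rLim rV ;; CSub rAddr rAddr rOne ;; CStore rAddr rA"
  \<comment> \<open>Writes go to \<open>L - 1 + k\<close>, never below \<open>L - 1\<close>, so
    every source cell that matters still has its original contents when it is read.\<close>
  let ?I = "\<lambda>k t. t (V rLim) = int L \<and> t (V rOne) = 1 \<and> (\<forall>a < L - 1. t (H a) = s (H a)) \<and>
    (\<forall>j. k \<le> j \<and> 32 + j < L \<longrightarrow> t (H (L - 1 + j)) = x (31 + j))"
  let ?s = "s(V rOne := 1)"
  have "?I 0 (foldr (\<lambda>k s. sem ?body (s(V rV := int k))) [0..<L] (?s(V rV := int L)))"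
  proof (rule foldr_upt_invariant[where I = ?I])
    fix k t
    assume t: "?I (Suc k) t"
    have "nat (int L + int k - 1) = L - 1 + k" using L by simp
    then have eq: "sem ?body (t(V rV := int k)) =
        t(V rV := int k, V rA := t (H k), V rAddr := int L + int k - 1, H (L - 1 + k) := t (H k))"
      using t by (auto simp: fun_eq_iff)
    have k: "t (H k) = x (31 + k)" if "32 + k < L"
      using t x(1)[OF that] that by simp
    show "?I k (sem ?body (t(V rV := int k)))"
      unfolding eq
    proof (intro conjI allI impI)
      fix j assume j: "k \<le> j \<and> 32 + j < L"
      show "(t(V rV := int k, V rA := t (H k), V rAddr := int L + int k - 1,
          H (L - 1 + k) := t (H k))) (H (L - 1 + j)) = x (31 + j)"
      proof (cases "j = k")
        case True
        then show ?thesis using k j by simp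
      next
        case False
        then have "Suc k \<le> j" using j by simp
        then have "t (H (L - 1 + j)) = x (31 + j)" using t j by blast
        then show ?thesis using False by simp
      qed
    qed (use t in auto)
  qed (use s in auto)
  moreover have "?s (V rLim) = int L" using s by simp
  ultimately have I: "?I 0 (sem copy_input s)"
    unfolding copy_input_def sem.simps(8)[of "CConst rOne 1"] sem.simps(2) using sem_loop by metis
  show "sem copy_input s (H (L - 32 + i)) = x i" if "i < L - 1"
  proof (cases "i < 31")
    case True
    then show ?thesis using I x(2) L by simp
  next
    case False
    then have "32 + (i - 31) < L" using that by simp
    then have "sem copy_input s (H (L - 1 + (i - 31))) = x (31 + (i - 31))" using I by blast
    moreover have "L - 1 + (i - 31) = L - 32 + i" using False L by simp
    ultimately show ?thesis using False by simp
  qed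
  show "sem copy_input s (V rLim) = int L" using I by blast
qed

text \<open>Besides the sources only register 0, the moving pointer, and register 1, the increment,
  are used: every other low register may still hold input.\<close>

definition save_code :: "nat \<Rightarrow> instr list" where
  "save_code m = concat (map (\<lambda>j. [Add 0 0 1, Store 0 j]) [2..<2 + m])"

lemma length_save_code: "length (save_code m) = 2 * m"
  by (induction m) (simp_all add: save_code_def)

text \<open>The condition \<open>m + 2 \<le> L\<close> puts the destinations above all sources,
  registers 2 to \<open>m + 1\<close>, so nothing is overwritten before it is read.\<close>

lemma reach_save_code:
  assumes "code_at P k (save_code m)" and "R 0 = int L" "R 1 = 1" and "m + 2 \<le> L"
  shows "reach P (2 * m) (k, R) (k + 2 * m, \<lambda>i. if i = 0 then int (L + m)
    else if L < i \<and> i \<le> L + m then R (i - L + 1) else R i)"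
  using assms(1,4)
proof (induction m)
  case 0
  show ?case using assms(2) by (auto simp: fun_eq_iff)
next
  case (Suc m)
  let ?R = "\<lambda>m i. if i = 0 then int (L + m) else if L < i \<and> i \<le> L + m then R (i - L + 1) else R i"
  have code: "code_at P k (save_code m)" "code_at P (k + 2 * m) [Add 0 0 1, Store 0 (2 + m)]"
    using Suc.prems(1) length_save_code[of m] by (simp_all add: save_code_def code_at_append)
  have 1: "reach P (2 * m) (k, R) (k + 2 * m, ?R m)"
    using Suc code(1) by simp
  have eq: "(?R m)(0 := int (L + m) + 1, Suc (L + m) := R (2 + m)) = ?R (Suc m)"
    using Suc.prems(2) by (auto simp: fun_eq_iff)
  have "nat (int L + int m + 1) = Suc (L + m)" by simp
  then have 2: "reach P 2 (k + 2 * m, ?R m)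
      (k + 2 * m + 2, (?R m)(0 := int (L + m) + 1, Suc (L + m) := R (2 + m)))"
    using code(2) assms(2,3) Suc.prems(2) by (simp add: small_numerals)
  have "2 * Suc m = 2 * m + 2" "k + 2 * Suc m = k + 2 * m + 2" by simp_all
  then show ?case using reach_trans[OF 1 2] unfolding eq by simp
qed

text \<open>
  Initially no register is free. Doubling register 0 six times makes it the address
  \<open>L = 64 * length xs\<close> of an unused block, to which registers 1 to 31 are moved.
\<close>

definition move_code :: "instr list" where
  "move_code =
     replicate 6 (Add 0 0 0) @ [Store 0 1, Const 1 1] @ save_code 30"

lemma reach_move_code:
  assumes "code_at P k move_code" and "xs \<noteq> []" and L: "L = 64 * length xs"
  shows "\<exists>R. reach P 68 (k, init xs) (k + 68, R) \<and> R 0 = int L + 30 \<and>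
    (\<forall>i<31. R (L + i) = init xs (Suc i)) \<and> (\<forall>j. 32 \<le> j \<and> j < L \<longrightarrow> R j = init xs j)"
proof -
  \<comment> \<open>For a nonempty input the new block starts at 64 or later, clear of registers 0
    to 31.\<close>
  have pos: "64 \<le> L" using assms(2) L by (cases xs) auto
  have code: "code_at P k (replicate 6 (Add 0 0 0))" "code_at P (k + 6) [Store 0 1, Const 1 1]"
    "code_at P (k + 8) (save_code 30)"
    using assms(1) by (simp_all add: move_code_def code_at_append add.commute[of 8 k])
  have "init xs 0 = int (length xs)" by (simp add: init_def)
  then have "reach P 6 (k, init xs) (k + 6, (init xs)(0 := int L))"
    using code(1) by (simp add: small_numerals L)
  moreover have "reach P 2 (k + 6, (init xs)(0 := int L))
      (k + 6 + 2, (init xs)(0 := int L, L := init xs 1, 1 := 1))"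
    using code(2) by (simp add: small_numerals)
  ultimately have "reach P (6 + 2) (k, init xs)
      (k + 6 + 2, (init xs)(0 := int L, L := init xs 1, 1 := 1))"
    by (rule reach_trans)
  then have 1: "reach P 8 (k, init xs) (k + 8, (init xs)(0 := int L, L := init xs 1, 1 := 1))"
    by (simp add: add.commute[of 8 k])
  let ?R = "(init xs)(0 := int L, L := init xs 1, 1 := 1)"
  have "reach P 60 (k + 8, ?R) (k + 68, \<lambda>i. if i = 0 then int (L + 30)
      else if L < i \<and> i \<le> L + 30 then ?R (i - L + 1) else ?R i)"
    using reach_save_code[OF code(3), of ?R L] pos by (simp add: add.commute[of 68 k])
  moreover define R where "R = (\<lambda>i. if i = 0 then int (L + 30)
      else if L < i \<and> i \<le> L + 30 then ?R (i - L + 1) else ?R i)"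
  ultimately have "reach P 60 (k + 8, ?R) (k + 68, R)" by simp
  from reach_trans[OF 1 this] have "reach P 68 (k, init xs) (k + 68, R)" by simp
  moreover have "R 0 = int L + 30" "\<forall>i<31. R (L + i) = init xs (Suc i)"
    "\<forall>j. 32 \<le> j \<and> j < L \<longrightarrow> R j = init xs j"
    using pos by (auto simp: R_def)
  ultimately show ?thesis by blast
qed


section \<open>Acceptance and Lipschitz extensions\<close>

lemma length_rows: "length (concat (map (\<lambda>u. map (g u) [0..<n]) [0..<m])) = m * n"
  by (induction m) simp_all

lemma nth_rows:
  "u < m \<Longrightarrow> v < n \<Longrightarrow> concat (map (\<lambda>u. map (g u) [0..<n]) [0..<m]) ! (u * n + v) = g u v"
proof (induction m)
  case (Suc m)
  show ?case
  proof (cases "u = m")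
    case True
    then show ?thesis using Suc.prems by (simp add: nth_append length_rows)
  next
    case False
    then have "u < m" using Suc.prems by simp
    then have "Suc u * n \<le> m * n" by (intro mult_le_mono1) simp
    then have "u * n + v < m * n" using Suc.prems by simp
    then show ?thesis using Suc \<open>u < m\<close> by (simp add: nth_append length_rows)
  qed
qed simp

lemma length_encode: "length (encode_instance n E V' f') = n * n + 2 * n + 1"
  by (simp add: encode_instance_def length_rows)

lemma nth_encode:
  shows "encode_instance n E V' f' ! 0 = int n"
    and "u < n \<Longrightarrow> v < n \<Longrightarrow> encode_instance n E V' f' ! (1 + u * n + v) = of_bool ({u, v} \<in> E)"
    and "v < n \<Longrightarrow> encode_instance n E V' f' ! (1 + n * n + v) = of_bool (v \<in> V')"
    and "v < n \<Longrightarrow> encode_instance n E V' f' ! (1 + n * n + n + v) = (if v \<in> V' then f' v else 0)"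
proof -
  let ?A = "concat (map (\<lambda>u. map (\<lambda>v. of_bool ({u, v} \<in> E) :: int) [0..<n]) [0..<n])"
  have len: "length ?A = n * n" by (rule length_rows)
  show "encode_instance n E V' f' ! 0 = int n" by (simp add: encode_instance_def)
  show "encode_instance n E V' f' ! (1 + u * n + v) = of_bool ({u, v} \<in> E)" if "u < n" "v < n"
  proof -
    have "Suc u * n \<le> n * n" using that(1) by (intro mult_le_mono1) simp
    then have "u * n + v < n * n" using that(2) by simp
    then show ?thesis
      using nth_rows[OF that, of "\<lambda>u v. of_bool ({u, v} \<in> E) :: int"] len
      by (simp add: encode_instance_def nth_append)
  qed
  show "encode_instance n E V' f' ! (1 + n * n + v) = of_bool (v \<in> V')" if "v < n"
    using that len by (simp add: encode_instance_def nth_append)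
  show "encode_instance n E V' f' ! (1 + n * n + n + v) = (if v \<in> V' then f' v else 0)" if "v < n"
    using that len by (simp add: encode_instance_def nth_append)
qed

lemma encode_eqI:
  assumes "length xs = n * n + 2 * n + 1" and "xs ! 0 = int n"
    and "\<And>u v. u < n \<Longrightarrow> v < n \<Longrightarrow> xs ! (1 + u * n + v) = of_bool ({u, v} \<in> E)"
    and "\<And>v. v < n \<Longrightarrow> xs ! (1 + n * n + v) = of_bool (v \<in> V')"
    and "\<And>v. v < n \<Longrightarrow> xs ! (1 + n * n + n + v) = (if v \<in> V' then f' v else 0)"
  shows "xs = encode_instance n E V' f'"
proof (rule nth_equalityI)
  show "length xs = length (encode_instance n E V' f')" using assms(1) by (simp add: length_encode)
  fix i assume "i < length xs"
  then have i: "i < n * n + 2 * n + 1" using assms(1) by simp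
  consider "i = 0" | "0 < i" "i \<le> n * n" | v where "i = 1 + n * n + v" "v < n"
    | v where "i = 1 + n * n + n + v" "v < n"
  proof -
    assume a: "i = 0 \<Longrightarrow> thesis" "0 < i \<Longrightarrow> i \<le> n * n \<Longrightarrow> thesis"
      "\<And>v. i = 1 + n * n + v \<Longrightarrow> v < n \<Longrightarrow> thesis"
      "\<And>v. i = 1 + n * n + n + v \<Longrightarrow> v < n \<Longrightarrow> thesis"
    show thesis
    proof (cases "i \<le> n * n")
      case True
      then show thesis using a(1,2) by blast
    next
      case False
      then show thesis
        using a(3)[of "i - (1 + n * n)"] a(4)[of "i - (1 + n * n + n)"] i by linarith
    qed
  qed
  then show "xs ! i = encode_instance n E V' f' ! i"
  proof cases
    case 2
    have "0 < n" using 2 by (cases n) auto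
    \<comment> \<open>Division with remainder recovers row and column; the offset 1 skips the
      leading entry \<open>n\<close>.\<close>
    let ?u = "(i - 1) div n" and ?v = "(i - 1) mod n"
    have "i - 1 < n * n" using 2 by simp
    then have u: "?u < n" by (simp add: less_mult_imp_div_less)
    have v: "?v < n" using \<open>0 < n\<close> by simp
    have "i = 1 + ?u * n + ?v" using 2 by (simp add: div_mult_mod_eq)
    then show ?thesis using assms(3)[OF u v] nth_encode(2)[OF u v] by metis
  qed (use assms nth_encode in simp_all)
qed

section \<open>Graph-theoretic meaning of the relaxed values\<close>

lemma card_edges_le:
  fixes n :: nat
  shows "card {(u, v). u < n \<and> v < n \<and> P u v} \<le> n * n"
proof -
  have "card {(u, v). u < n \<and> v < n \<and> P u v} \<le> card ({..<n} \<times> {..<n})"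
    by (intro card_mono) auto
  then show ?thesis by simp
qed

text \<open>Relaxation with step 0 yields the greatest function below the start values that never
  increases along an edge. Zero spreads through the component of vertex 0, and any other vertex
  keeps the value 1.\<close>

lemma connected_iff_reach_bound:
  assumes a: "\<And>u v. u < n \<Longrightarrow> v < n \<Longrightarrow> a u v = of_bool ({u, v} \<in> E)"
    and E: "finite_simple_graph {..<n} E" and L: "n * n \<le> L" and n: "0 < n"
  shows "connected_graph {..<n} E \<longleftrightarrow> (\<forall>v<n. reach_bound L n a v \<le> 0)"
proof -
  define r where "r = {(x, y). {x, y} \<in> E}"
  have r: "{(u, v). u < n \<and> v < n \<and> adj_of a u v} = r"
  proof -
    have "u < n \<and> v < n" if "{u, v} \<in> E" for u v
      using E that by (fastforce simp: finite_simple_graph_def doubleton_eq_iff)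
    then show ?thesis using a by (auto simp: r_def)
  qed
  have "sym r" by (auto simp: r_def sym_def insert_commute)
  then have sym: "(u, v) \<in> r\<^sup>* \<Longrightarrow> (v, u) \<in> r\<^sup>*" for u v
    by (meson sym_rtrancl symD)
  have card: "card {(u, v). u < n \<and> v < n \<and> adj_of a u v} \<le> L"
    using card_edges_le[of n "adj_of a"] L by linarith
  note C = sweeps_greatest[OF order_refl card, of "reach_bound L n a", OF reach_bound_def,
      unfolded r]
  have C0: "reach_bound L n a v \<le> 0" if "(0, v) \<in> r\<^sup>*" for v
    using that
  proof (induction rule: rtrancl_induct)
    case base
    show ?case using C(1)[of 0] by simp
  next
    case (step v w)
    then show ?case using C(2)[OF step(2)] by simp
  qed
  have C1: "(0, v) \<in> r\<^sup>*" if "reach_bound L n a v \<le> 0" "v < n" for v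
  proof (rule ccontr)
    assume v: "(0, v) \<notin> r\<^sup>*"
    \<comment> \<open>The indicator of the vertices not reachable from 0 does not increase along
      edges, so by maximality it lies below \<open>reach_bound\<close>.\<close>
    let ?y = "\<lambda>v. if (0, v) \<in> r\<^sup>* then 0 else (1 :: int)"
    have "?y v \<le> reach_bound L n a v"
      by (rule C(3)) (auto intro: rtrancl_into_rtrancl that)
    then show False using v that by simp
  qed
  show ?thesis
  proof
    assume "connected_graph {..<n} E"
    then show "\<forall>v<n. reach_bound L n a v \<le> 0"
      using C0 n by (auto simp: connected_graph_def r_def)
  next
    assume "\<forall>v<n. reach_bound L n a v \<le> 0"
    then have *: "(0, v) \<in> r\<^sup>*" if "v < n" for v using C1 that by blast
    have "(u, v) \<in> r\<^sup>*" if "u < n" "v < n" for u v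
      using rtrancl_trans[OF sym[OF *[OF that(1)]] *[OF that(2)]] .
    then show "connected_graph {..<n} E"
      using n by (auto simp: connected_graph_def r_def)
  qed
qed

lemma extension_iff_bounds:
  assumes a: "\<And>u v. u < n \<Longrightarrow> v < n \<Longrightarrow> a u v = of_bool ({u, v} \<in> E)"
    and w: "\<And>v. v < n \<Longrightarrow> w v = of_bool (v \<in> V')" and f: "\<And>v. v \<in> V' \<Longrightarrow> f v = f' v"
    and E: "finite_simple_graph {..<n} E" and V': "V' \<subseteq> {..<n}" and L: "n * n \<le> L"
    and M: "0 < M" and conn: "connected_graph {..<n} E"
  shows "(\<exists>y. lipschitz_mapping M {..<n} E y \<and> (\<forall>v\<in>V'. y v = f' v)) \<longleftrightarrow>
    (\<forall>v<n. 0 \<le> upper_bound M L n a w f v + upper_bound M L n a w (\<lambda>v. - f v) v) \<and>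
    (\<exists>v<n. 0 \<le> upper_bound M L n a w f v \<and> 0 \<le> upper_bound M L n a w (\<lambda>v. - f v) v)"
    (is "?L \<longleftrightarrow> ?R")
proof -
  define r where "r = {(x, y). {x, y} \<in> E}"
  have En: "u < n \<and> v < n" if "{u, v} \<in> E" for u v
    using E that by (fastforce simp: finite_simple_graph_def doubleton_eq_iff)
  then have r: "{(u, v). u < n \<and> v < n \<and> adj_of a u v} = r"
    using a by (auto simp: r_def)
  have card: "card {(u, v). u < n \<and> v < n \<and> adj_of a u v} \<le> L"
    using card_edges_le[of n "adj_of a"] L by linarith
  have fin: "finite r"
    by (rule finite_subset[of _ "{..<n} \<times> {..<n}"]) (auto simp: r_def En)
  define G where "G = upper_bound M L n a w f"
  \<comment> \<open>\<open>- K\<close> is the lower bound, so \<open>0 \<le> G v + K v\<close> says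
    that the lower bound does not exceed the upper one.\<close>
  define K where "K = upper_bound M L n a w (\<lambda>v. - f v)"
  have M0: "0 \<le> M" using M by simp
  note G = sweeps_greatest[OF M0 card, of G, OF G_def[unfolded upper_bound_def], unfolded r]
  note K = sweeps_greatest[OF M0 card, of K, OF K_def[unfolded upper_bound_def], unfolded r]
  have "?L \<longleftrightarrow> (\<forall>v<n. 0 \<le> G v + K v) \<and> (\<exists>v<n. 0 \<le> G v \<and> 0 \<le> K v)"
  proof
    assume ?L
    then obtain y \<rho> where y: "\<And>u v. {u, v} \<in> E \<Longrightarrow> \<bar>y u - y v\<bar> \<le> M" "\<forall>v\<in>V'. y v = f' v"
      and \<rho>: "\<rho> < n" "y \<rho> = 0"
      by (auto simp: lipschitz_mapping_def)
    have walk: "\<bar>y v\<bar> \<le> M * int k" if "(\<rho>, v) \<in> r ^^ k" for k v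
      using that
    proof (induction k arbitrary: v)
      case (Suc k)
      then obtain u where "(\<rho>, u) \<in> r ^^ k" "{u, v} \<in> E" by (auto simp: r_def)
      then show ?case using Suc.IH[of u] y(1)[of u v] by (simp add: algebra_simps)
    qed (use \<rho> in simp)
    \<comment> \<open>Connectedness gives a walk of at most \<open>card r \<le> L\<close> edges from
      the zero of \<open>y\<close>, so the start value \<open>M * L\<close> at free vertices
      excludes no solution.\<close>
    have bound: "\<bar>y v\<bar> \<le> M * int L" if "v < n" for v
    proof -
      have "(\<rho>, v) \<in> r\<^sup>*" using conn \<rho>(1) that by (auto simp: connected_graph_def r_def)
      then obtain k where k: "k \<le> card r" "(\<rho>, v) \<in> r ^^ k"
        using rtrancl_finite_eq_relpow[OF fin] by auto
      have "M * int k \<le> M * int L" using k(1) card r M0 by (intro mult_left_mono) auto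
      then show ?thesis using walk[OF k(2)] by linarith
    qed
    have yG: "y v \<le> G v" if "v < n" for v
    proof (rule G(3)[OF _ _ that])
      show "\<forall>v<n. y v \<le> (if 0 < w v then f v else M * int L)"
        using bound w f y(2) by (auto simp: abs_le_iff)
      show "\<forall>(u, v)\<in>r. y v \<le> y u + M" using y(1) by (fastforce simp: r_def abs_le_iff)
    qed
    have yK: "- y v \<le> K v" if "v < n" for v
    proof (rule K(3)[OF _ _ that])
      show "\<forall>v<n. - y v \<le> (if 0 < w v then - f v else M * int L)"
        using bound w f y(2) by (auto simp: abs_le_iff)
      show "\<forall>(u, v)\<in>r. - y v \<le> - y u + M" using y(1) by (fastforce simp: r_def abs_le_iff)
    qed
    have "0 \<le> G v + K v" if "v < n" for v using yG[OF that] yK[OF that] by linarith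
    moreover have "0 \<le> G \<rho> \<and> 0 \<le> K \<rho>" using yG[OF \<rho>(1)] yK[OF \<rho>(1)] \<rho>(2) by simp
    ultimately show "(\<forall>v<n. 0 \<le> G v + K v) \<and> (\<exists>v<n. 0 \<le> G v \<and> 0 \<le> K v)"
      using \<rho>(1) by blast
  next
    assume R: "(\<forall>v<n. 0 \<le> G v + K v) \<and> (\<exists>v<n. 0 \<le> G v \<and> 0 \<le> K v)"
    then obtain \<rho> where \<rho>: "\<rho> < n" "0 \<le> G \<rho>" "0 \<le> K \<rho>" by blast
    \<comment> \<open>Truncation by minimum and maximum preserves the Lipschitz condition, and at
      \<rho> it returns 0 because 0 lies between \<open>- K \<rho>\<close> and
      \<open>G \<rho>\<close>.\<close>
    let ?y = "\<lambda>v. max (- K v) (min (G v) 0)"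
    have "\<bar>?y u - ?y v\<bar> \<le> M" if "{u, v} \<in> E" for u v
    proof -
      have "(u, v) \<in> r" "(v, u) \<in> r" using that by (auto simp: r_def insert_commute)
      then have "G v \<le> G u + M" "G u \<le> G v + M" "K v \<le> K u + M" "K u \<le> K v + M"
        using G(2) K(2) by blast+
      then show ?thesis using M by (auto simp: max_def min_def)
    qed
    moreover have "?y \<rho> = 0" using \<rho> by simp
    \<comment> \<open>Here \<open>G\<close> does not exceed the prescribed value, \<open>- K\<close>
      does not fall below it, and \<open>- K \<le> G\<close>, so all three coincide.\<close>
    moreover have "?y v = f' v" if "v \<in> V'" for v
    proof -
      have v: "v < n" "0 < w v" using that V' w by auto
      have "G v \<le> f' v" "K v \<le> - f' v"
        using G(1)[of v] K(1)[of v] v(2) f[OF that] by simp_all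
      moreover have "0 \<le> G v + K v" using R v(1) by blast
      ultimately show ?thesis by linarith
    qed
    ultimately show ?L using \<rho>(1) unfolding lipschitz_mapping_def
      by (intro exI[of _ ?y] conjI) auto
  qed
  then show ?thesis by (simp only: G_def K_def)
qed

definition accepted :: "int \<Rightarrow> int list \<Rightarrow> bool" where
  "accepted M xs \<longleftrightarrow> (\<exists>n. xs ! 0 = int n \<and> length xs = n * n + 2 * n + 1 \<and>
     accepts M (64 * length xs) n (\<lambda>u v. xs ! (1 + u * n + v)) (\<lambda>v. xs ! (1 + n * n + v))
       (\<lambda>v. xs ! (1 + n * n + n + v)))"

text \<open>Soundness also has to produce an instance: \<open>E\<close> and \<open>V'\<close> are
  read off the list, and the checks make the list the encoding of that very instance.\<close>

lemma accepted_iff: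
  assumes M: "0 < M"
  shows "accepted M xs \<longleftrightarrow> xs \<in> lipschitz_extension_problem M"
proof
  assume "accepted M xs"
  then obtain n where n: "xs ! 0 = int n" "length xs = n * n + 2 * n + 1"
    and acc: "accepts M (64 * length xs) n (\<lambda>u v. xs ! (1 + u * n + v)) (\<lambda>v. xs ! (1 + n * n + v))
       (\<lambda>v. xs ! (1 + n * n + n + v))"
    unfolding accepted_def by blast
  define a where "a = (\<lambda>u v. xs ! (1 + u * n + v))"
  define w where "w = (\<lambda>v. xs ! (1 + n * n + v))"
  define f where "f = (\<lambda>v. xs ! (1 + n * n + n + v))"
  note acc = acc[folded a_def w_def f_def, unfolded accepts_def]
  define E where "E = {{u, v} | u v. u < n \<and> v < n \<and> a u v = 1}"
  define V' where "V' = {v. v < n \<and> w v = 1}"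
  have pair: "valid_pair a u v" if "u < n" "v < n" for u v using acc that by blast
  have aE: "a u v = of_bool ({u, v} \<in> E)" if "u < n" "v < n" for u v
  proof -
    have "a u v = a v u" "a u v = 0 \<or> a u v = 1"
      using pair[OF that] pair[OF that(2,1)] by (auto simp: valid_pair_def)
    then show ?thesis using that by (auto simp: E_def doubleton_eq_iff)
  qed
  have simple: "finite_simple_graph {..<n} E"
  proof -
    have "u \<noteq> v" if "u < n" "v < n" "a u v = 1" for u v
      using pair[OF that(1,2)] that(3) by (auto simp: valid_pair_def)
    then show ?thesis by (fastforce simp: finite_simple_graph_def E_def)
  qed
  have vertex: "valid_vertex w f v" if "v < n" for v using acc that by blast
  have wV: "w v = of_bool (v \<in> V')" and fV: "f v = (if v \<in> V' then f v else 0)" if "v < n" for v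
    using vertex[OF that] that by (auto simp: V'_def valid_vertex_def)
  have "xs = encode_instance n E V' f"
    using n aE wV fV by (intro encode_eqI) (simp_all add: a_def w_def f_def)
  moreover have V': "V' \<subseteq> {..<n}" by (auto simp: V'_def)
  moreover have pos: "0 < n" using acc by auto
  have L: "n * n \<le> 64 * length xs" using n(2) by linarith
  have conn: "connected_graph {..<n} E"
    using connected_iff_reach_bound[of n a E, OF aE simple L pos] acc by blast
  moreover have "\<exists>y. lipschitz_mapping M {..<n} E y \<and> (\<forall>v\<in>V'. y v = f v)"
    using extension_iff_bounds[of n a E w V' f f, OF aE wV refl simple V' L M conn] acc by blast
  ultimately show "xs \<in> lipschitz_extension_problem M"
    using simple unfolding lipschitz_extension_problem_def by blast
next
  assume "xs \<in> lipschitz_extension_problem M"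
  then obtain n E V' f' y where xs: "xs = encode_instance n E V' f'"
    and E: "finite_simple_graph {..<n} E" and conn: "connected_graph {..<n} E"
    and V': "V' \<subseteq> {..<n}" and y: "lipschitz_mapping M {..<n} E y" "\<forall>v\<in>V'. y v = f' v"
    unfolding lipschitz_extension_problem_def by blast
  have n: "xs ! 0 = int n" "length xs = n * n + 2 * n + 1"
    by (simp_all only: xs nth_encode length_encode)
  define a where "a = (\<lambda>u v. xs ! (1 + u * n + v))"
  define w where "w = (\<lambda>v. xs ! (1 + n * n + v))"
  define f where "f = (\<lambda>v. xs ! (1 + n * n + n + v))"
  have a: "a u v = of_bool ({u, v} \<in> E)" if "u < n" "v < n" for u v
    using that by (simp only: a_def xs nth_encode)
  have w: "w v = of_bool (v \<in> V')" and f: "f v = (if v \<in> V' then f' v else 0)" if "v < n" for v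
    using that by (simp_all only: w_def f_def xs nth_encode)
  have fV: "f v = f' v" if "v \<in> V'" for v using f V' that by auto
  have pos: "0 < n" using conn by (auto simp: connected_graph_def)
  have L: "n * n \<le> 64 * length xs" using n(2) by linarith
  have "valid_pair a u v" if "u < n" "v < n" for u v
  proof -
    have "{u, u} \<notin> E" using E by (auto simp: finite_simple_graph_def doubleton_eq_iff)
    then show ?thesis using that a by (auto simp: valid_pair_def insert_commute)
  qed
  moreover have "valid_vertex w f v" if "v < n" for v
    using that w f by (simp add: valid_vertex_def)
  moreover have "\<forall>v<n. reach_bound (64 * length xs) n a v \<le> 0"
    using connected_iff_reach_bound[of n a E, OF a E L pos] conn by blast
  moreover note extension_iff_bounds[of n a E w V' f f', OF a w fV E V' L M conn]
  ultimately have "accepts M (64 * length xs) n a w f"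
    using y unfolding accepts_def by blast
  then show "accepted M xs"
    using n unfolding accepted_def a_def w_def f_def by blast
qed


section \<open>The machine program\<close>

text \<open>\<open>move_code\<close> leaves register 0 pointing 30 past the start of the block; this
  restores \<open>L\<close>.\<close>

definition shift_com :: com where
  "shift_com = CConst rA 30 ;; CSub rLim rLim rA"

text \<open>Since \<open>rLim\<close> and \<open>rN\<close> are written as well as used as loop
  bounds, no single \<open>K\<close> makes the whole \<open>loops_bounded\<close>; the phases are
  timed one by one. The last copy delivers the answer in register 0, the register of
  \<open>rLim\<close>.\<close>

definition program_com :: "int \<Rightarrow> com" where
  "program_com M = shift_com ;; copy_input ;; load_size ;; main_com M ;; CCopy rLim rFound"

text \<open>The first two instructions reject the empty input, for which \<open>L\<close> would be
  0. With the 68 instructions of \<open>move_code\<close> the compiled part begins at 70.\<close>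

definition program :: "int \<Rightarrow> instr list" where
  "program M =
     JumpPos 0 2 # Jump (70 + csize (program_com M)) # move_code @ compile 70 (program_com M)"

lemma length_program: "length (program M) = 70 + csize (program_com M)"
  by (simp add: program_def move_code_def length_save_code length_comp)

text \<open>Cutting off the first entry does no harm: an encoding has
  \<open>n \<le> length xs \<le> L\<close>, and conversely \<open>accepts\<close> supplies a vertex
  below \<open>m\<close>, so \<open>m\<close> is not the default 0 and equals the entry.\<close>

lemma accepted_iff_accepts:
  assumes L: "L = 64 * length xs" and "xs \<noteq> []"
    and m: "m = (if 0 \<le> xs ! 0 \<and> xs ! 0 \<le> int L then nat (xs ! 0) else 0)"
  shows "accepted M xs \<longleftrightarrow> 64 * (m * m + 2 * m + 1) = L \<and>
    accepts M L m (\<lambda>u v. xs ! (1 + u * m + v)) (\<lambda>v. xs ! (1 + m * m + v))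
      (\<lambda>v. xs ! (1 + m * m + m + v))"
    (is "_ \<longleftrightarrow> _ \<and> ?acc m")
proof
  assume "accepted M xs"
  then obtain n where n: "xs ! 0 = int n" "length xs = n * n + 2 * n + 1" "?acc n"
    unfolding accepted_def L by blast
  have "n \<le> length xs" using n(2) by simp
  then have "n \<le> L" using L by linarith
  then have "m = n" using m n(1) by simp
  then show "64 * (m * m + 2 * m + 1) = L \<and> ?acc m" using n(2,3) L by simp
next
  assume R: "64 * (m * m + 2 * m + 1) = L \<and> ?acc m"
  have len: "length xs = m * m + 2 * m + 1"
    using R[THEN conjunct1] unfolding L by (metis mult_cancel_left zero_neq_numeral)
  obtain v where "v < m" using R unfolding accepts_def by blast
  then have "xs ! 0 = int m" using m by (simp split: if_splits)
  then show "accepted M xs" using R len unfolding accepted_def L by blast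
qed

lemma reach_program:
  assumes ne: "xs \<noteq> []" and L: "L = 64 * length xs"
  shows "\<exists>t R. reach (program M) t (0, init xs) (length (program M), R) \<and>
    t \<le> 69 + poly (time_poly (program_com M)) L \<and> (R 0 = 1 \<longleftrightarrow> accepted M xs)"
proof -
  let ?P = "program M"
  have pos: "64 \<le> L" using ne L by (cases xs) auto
  have code: "code_at ?P 0 ?P" using code_at_self[of "[]" ?P] by simp
  define k1 where "k1 = 70 + csize shift_com"
  define k2 where "k2 = k1 + csize copy_input"
  define k3 where "k3 = k2 + csize load_size"
  define k4 where "k4 = k3 + csize (main_com M)"
  have len: "length move_code = 68" by (simp add: move_code_def length_save_code)
  have code: "0 < length ?P" "?P ! 0 = JumpPos 0 2" "code_at ?P 2 move_code"
    "code_at ?P 70 (compile 70 shift_com)" "code_at ?P k1 (compile k1 copy_input)"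
    "code_at ?P k2 (compile k2 load_size)" "code_at ?P k3 (compile k3 (main_com M))"
    "code_at ?P k4 (compile k4 (CCopy rLim rFound))"
    using code unfolding program_def program_com_def k1_def k2_def k3_def k4_def
    by (simp_all add: code_at_append length_comp len small_numerals(1) del: compile.simps(1-7,9-10))
  have "init xs 0 > 0" using ne by (simp add: init_def)
  then have r0: "reach ?P 1 (0, init xs) (2, init xs)" using code(1,2) by simp
  obtain R0 where R0: "reach ?P 68 (2, init xs) (70, R0)" "R0 0 = int L + 30"
    "\<And>i. i < 31 \<Longrightarrow> R0 (L + i) = init xs (Suc i)"
    "\<And>j. 32 \<le> j \<Longrightarrow> j < L \<Longrightarrow> R0 j = init xs j"
    using reach_move_code[OF code(3) ne L] by auto
  \<comment> \<open>Apart from \<open>rLim\<close>, the variables start with whatever is left in the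
    low registers; nothing is assumed about them.\<close>
  define s0 where "s0 l = (case l of V x \<Rightarrow> R0 (reg x) | H a \<Rightarrow> R0 (32 + a))" for l
  have rep0: "represents R0 s0" by (simp add: represents_def s0_def)
  define s1 where "s1 = sem shift_com s0"
  have s1: "s1 (V rLim) = int L" "s1 (H a) = s0 (H a)" for a
    using R0(2) by (simp_all add: s1_def shift_com_def s0_def)
  have "loops_bounded {} shift_com" by (simp add: shift_com_def)
  from comp_correct[OF this _ code(4) rep0, of L]
  obtain t1 R1 where r1: "reach ?P t1 (70, R0) (k1, R1)" "represents R1 s1"
    "t1 \<le> poly (time_poly shift_com) L"
    unfolding s1_def k1_def by auto
  define s2 where "s2 = sem copy_input s1"
  from comp_correct[OF loops_bounded_copy_input _ code(5) r1(2), of L] s1(1)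
  obtain t2 R2 where r2: "reach ?P t2 (k1, R1) (k2, R2)" "represents R2 s2"
    "t2 \<le> poly (time_poly copy_input) L"
    unfolding s2_def k2_def by auto
  have s2: "i < L - 1 \<Longrightarrow> s2 (H (L - 32 + i)) = init xs (Suc i)" "s2 (V rLim) = int L" for i
  proof -
    have a: "s1 (H j) = init xs (Suc (31 + j))" if "32 + j < L" for j
      using that R0(4)[of "32 + j"] by (simp add: s1(2) s0_def)
    have b: "s1 (H (L - 32 + i)) = init xs (Suc i)" if "i < 31" for i
      using that R0(3)[OF that] pos by (simp add: s1(2) s0_def)
    show "i < L - 1 \<Longrightarrow> s2 (H (L - 32 + i)) = init xs (Suc i)" "s2 (V rLim) = int L"
      unfolding s2_def
      using sem_copy_input[where s = s1 and L = L and x = "\<lambda>i. init xs (Suc i)", OF s1(1) pos a b] by blast+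
  qed
  have cells: "s2 (H (L - 32 + i)) = xs ! i" if "i < length xs" for i
  proof -
    have "i < L - 1" using that L by linarith
    then show ?thesis using s2(1) that by (simp add: init_def)
  qed
  define s3 where "s3 = sem load_size s2"
  from comp_correct[OF loops_bounded_load_size _ code(6) r2(2), of L] s2(2)
  obtain t3 R3 where r3: "reach ?P t3 (k2, R2) (k3, R3)" "represents R3 s3"
    "t3 \<le> poly (time_poly load_size) L"
    unfolding s3_def k3_def by auto
  define m where "m = (if 0 \<le> xs ! 0 \<and> xs ! 0 \<le> int L then nat (xs ! 0) else 0)"
  have "s2 (H (L - 32)) = xs ! 0" using cells[of 0] ne by simp
  from sem_load_size[OF s2(2) pos this]
  have s3: "s3 (V rN) = int m" "s3 (V rLim) = int L" "\<And>a. s3 (H a) = s2 (H a)"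
    by (simp_all add: s3_def m_def)
  have mL: "m \<le> L" by (auto simp: m_def)
  define s4 where "s4 = sem (main_com M) s3"
  from comp_correct[OF loops_bounded_main_com _ code(7) r3(2), of L] s3(1,2) mL
  obtain t4 R4 where r4: "reach ?P t4 (k3, R3) (k4, R4)" "represents R4 s4"
    "t4 \<le> poly (time_poly (main_com M)) L"
    unfolding s4_def k4_def by auto
  have s4: "s4 (V rFound) = (if accepted M xs then 1 else 0)"
  proof -
    have "s3 (H (L - 32 + i)) = xs ! i"
      if "i < m * m + 2 * m + 1" "64 * (m * m + 2 * m + 1) = L" for i
    proof -
      have "m * m + 2 * m + 1 = length xs"
        using that(2) unfolding L by (metis mult_cancel_left zero_neq_numeral)
      then show ?thesis using cells that(1) s3(3) by simp
    qed
    from sem_main_com[OF s3(2,1) pos this]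
    show ?thesis unfolding s4_def accepted_iff_accepts[OF L ne m_def] by simp
  qed
  have "loops_bounded {} (CCopy rLim rFound)" by simp
  from comp_correct[OF this _ code(8) r4(2), of L]
  obtain t5 R5 where r5: "reach ?P t5 (k4, R4) (k4 + 1, R5)"
    "represents R5 (sem (CCopy rLim rFound) s4)" "t5 \<le> 1"
    by auto
  have "R5 0 = s4 (V rFound)" using represents_reg[OF r5(2), of rLim] by simp
  moreover have "k4 + 1 = length ?P"
    by (simp add: length_program program_com_def k1_def k2_def k3_def k4_def)
  moreover note reach_trans[OF reach_trans[OF reach_trans[OF reach_trans[OF reach_trans[OF
    reach_trans[OF r0 R0(1)] r1(1)] r2(1)] r3(1)] r4(1)] r5(1)]
  moreover have "1 + 68 + t1 + t2 + t3 + t4 + t5 \<le> 69 + poly (time_poly (program_com M)) L"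
    using r1(3) r2(3) r3(3) r4(3) r5(3) by (simp add: program_com_def)
  ultimately show ?thesis using s4 by (intro exI[of _ "1 + 68 + t1 + t2 + t3 + t4 + t5"] exI[of _ R5]) auto
qed

lemma reach_program_Nil:
  "reach (program M) 2 (0, init []) (length (program M), init [])"
  by (simp add: small_numerals(1) length_program)
     (simp add: program_def init_def)

lemma not_accepted_Nil: "\<not> accepted M []"
  by (simp add: accepted_def)

section \<open>Polynomial bound on the logarithmic cost\<close>

lemma length_le_input_size: "length xs \<le> input_size xs"
  unfolding input_size_def by (induction xs) (simp_all add: bits_def)

lemma init_bound: "\<bar>init xs j\<bar> < 2 ^ input_size xs"
proof -
  have elem: "bits x \<le> input_size xs" if "x \<in> set xs" for x
    unfolding input_size_def using that by (intro member_le_sum_list) auto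
  consider "j = 0" | "0 < j" "j \<le> length xs" | "length xs < j" by linarith
  then show ?thesis
  proof cases
    case 1
    have "int (length xs) < 2 ^ length xs" by (rule of_nat_less_two_power)
    then have "\<bar>int (length xs)\<bar> < 2 ^ length xs" by simp
    from abs_less_power_mono[OF this length_le_input_size] show ?thesis using 1 by (simp add: init_def)
  next
    case 2
    then have "xs ! (j - 1) \<in> set xs" by simp
    from abs_less_power_mono[OF abs_less_bits elem[OF this]] show ?thesis
      using 2 by (simp add: init_def)
  qed (simp add: init_def)
qed

lemma poly_nat_mono: "x \<le> y \<Longrightarrow> poly p x \<le> poly p y" for p :: "nat poly"
  by (induction p) (auto intro!: add_mono mult_mono)

theorem theorem4:
  fixes M :: int
  assumes "M > 0"
  shows "polynomial_time_decidable (lipschitz_extension_problem M)"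
proof -
  let ?P = "program M"
  obtain b where b: "\<forall>i\<in>set ?P. instr_bound b i" using ex_instr_bound by blast
  \<comment> \<open>Number of instructions: \<open>L\<close> is at most 64 times the input size, and
    69 covers the initial test and \<open>move_code\<close>.\<close>
  define q where "q = [:69:] + pcompose (time_poly (program_com M)) [:0, 64:]"
  \<comment> \<open>This is the bound of \<open>exec_of_reach\<close> with \<open>q\<close> for the
    number of instructions and \<open>b\<close> increased by the input size, which bounds the
    initial contents.\<close>
  define p where "p = q * ([:5:] * ([:b + 1, 1:] + q))"
  have "\<exists>w R. exec ?P (0, init xs) w R \<and> w \<le> poly p (input_size xs) \<and>
    (R 0 = 1 \<longleftrightarrow> xs \<in> lipschitz_extension_problem M)" for xs
  proof -
    let ?n = "input_size xs"
    have "\<exists>t R. reach ?P t (0, init xs) (length ?P, R) \<and> t \<le> poly q ?n \<and>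
      (R 0 = 1 \<longleftrightarrow> accepted M xs)"
    proof (cases "xs = []")
      case True
      have "init [] 0 = 0" by (simp add: init_def)
      then show ?thesis
        using reach_program_Nil[of M] not_accepted_Nil[of M] unfolding True
        by (intro exI[of _ 2] exI[of _ "init []"]) (auto simp: q_def)
    next
      case False
      from reach_program[OF this refl, of M] obtain t R where
        t: "reach ?P t (0, init xs) (length ?P, R)" "R 0 = 1 \<longleftrightarrow> accepted M xs"
        "t \<le> 69 + poly (time_poly (program_com M)) (64 * length xs)" by blast
      have "64 * length xs \<le> 64 * ?n" using length_le_input_size by simp
      from poly_nat_mono[OF this, of "time_poly (program_com M)"] t(3)
      have "t \<le> poly q ?n" by (simp add: q_def poly_pcompose mult.commute)
      with t show ?thesis by blast
    qed
    then obtain t R where t: "reach ?P t (0, init xs) (length ?P, R)" "t \<le> poly q ?n"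
      "R 0 = 1 \<longleftrightarrow> accepted M xs" by blast
    have "\<forall>i\<in>set ?P. instr_bound (b + ?n) i"
      using b by (auto simp: instr_bound_def intro: abs_less_power_mono[OF _ le_add1])
    moreover have "\<forall>j. \<bar>init xs j\<bar> < 2 ^ (b + ?n)"
      using abs_less_power_mono[OF init_bound] by simp
    ultimately obtain w where w: "exec ?P (0, init xs) w R" "w \<le> t * (5 * (b + ?n + t + 1))"
      using exec_of_reach t(1) by blast
    have "t * (5 * (b + ?n + t + 1)) \<le> poly q ?n * (5 * (b + ?n + poly q ?n + 1))"
      using t(2) by (intro mult_le_mono) auto
    also have "\<dots> = poly p ?n" by (simp add: p_def algebra_simps)
    finally show ?thesis using w t(3) accepted_iff[OF assms] by (meson order_trans)
  qed
  then show ?thesis unfolding polynomial_time_decidable_def by blast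
qed

end
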